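(* Let $N>1$. There is a constant $C$, depending only on $N$, such that for every Borel measure $\nu$ on $\mathbf{R}^N$ with $M(\nu)<\infty$ and every $a=\mathrm{diag}(a_1,\dots,a_N)\in A_N^+$ with $\frac{a_N}{a_{N-1}}<\frac14$, $$\left|\int_{\mathbf{R}^N}\int_K\chi_B(akx)\,m_K(dk)\,\nu(dx)-\frac{2\sigma_{N-1}}{\sigma_N}\int_0^1\frac{N_\nu\left(\frac{\tau}{a_N}\right)}{\left(\frac{\tau}{a_N}\right)^N}(1-\tau^2)^{\frac{N-3}2}\,d\tau\right|\le C\,M(\nu)\left(\frac{a_N}{a_{N-1}}\right)^{2/3}.$$
   Context: $A_N^+$ is the set of diagonal matrices $a=\mathrm{diag}(a_1,\dots,a_N)$ with $\det a=1$ and $a_1>a_2>\cdots>a_N>0$. $K=\mathrm{SO}(N)$ with normalized Haar measure $m_K$. $B=B(0,1)$ is the open unit ball of $\mathbf{R}^N$ and $\chi_B$ its indicator function. $N_\nu(R)=\nu(B(0,R))$ and $M(\nu)=\sup_{0<R<\infty}N_\nu(R)/R^N$. $\sigma_N$ is the area of the unit sphere $S_{N-1}\subset\mathbf{R}^N$, with $\sigma_1=2$. *)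

theory Defs
  imports "HOL-Analysis.Analysis" "HOL-Probability.Probability_Measure"
begin

text \<open>
  Vectors and matrices are indexed by a finite linearly ordered type \<open>'n\<close>, with
  \<open>N = CARD('n)\<close>. The increasing enumeration of \<open>'n\<close> plays the role of the indices \<open>1, ..., N\<close>.
\<close>

definition SO :: "(real^'n^'n) set"
  where "SO = {k. rotation_matrix k}"

text \<open>
  The normalized Haar measure of \<open>SO(N)\<close> is characterized as the left-invariant Borel probability
  measure on it. As \<open>SO(N)\<close> is a compact metrizable group, such a measure exists, is unique, and is
  automatically regular and right-invariant.
\<close>

definition normalized_Haar_SO :: "(real^'n^'n) measure \<Rightarrow> bool"
  where "normalized_Haar_SO m \<longleftrightarrow>
    prob_space m \<and>
    sets m = sets (restrict_space borel SO) \<and>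
    (\<forall>g\<in>SO. distr m m (\<lambda>k. g ** k) = m)"

definition A_plus :: "(real^'n::{finite,linorder}^'n::{finite,linorder}) set"
  where "A_plus = {a. (\<forall>i j. i \<noteq> j \<longrightarrow> a $ i $ j = 0) \<and> det a = 1 \<and>
    (\<forall>i j. i < j \<longrightarrow> a $ i $ i > a $ j $ j) \<and> (\<forall>i. a $ i $ i > 0)}"

definition last_index :: "'n::{finite,linorder}"
  where "last_index = Max UNIV"

text \<open>Meaningful only if \<open>N > 1\<close>.\<close>

definition penultimate_index :: "'n::{finite,linorder}"
  where "penultimate_index = Max (UNIV - {last_index})"

definition N_mass :: "(real^'n) measure \<Rightarrow> real \<Rightarrow> ennreal"
  where "N_mass \<nu> R = emeasure \<nu> (ball 0 R)"

definition M_sup :: "(real^'n) measure \<Rightarrow> ennreal"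
  where "M_sup \<nu> = (SUP R\<in>{0<..}. N_mass \<nu> R / ennreal (R ^ CARD('n)))"

text \<open>
  Area of the unit sphere of \<open>\<real>\<^sup>n\<close>: \<open>n\<close> times the volume of the unit ball, i.e. the derivative at
  \<open>r = 1\<close> of the volume of the ball of radius \<open>r\<close>. The dimension is a number rather than a type
  because the areas in dimensions \<open>N\<close> and \<open>N - 1\<close> occur together.
\<close>

definition sphere_area :: "nat \<Rightarrow> real"
  where "sphere_area n = real n * unit_ball_vol (real n)"

lemma sphere_area_1: "sphere_area 1 = 2"
  by (simp add: sphere_area_def unit_ball_vol_1)

lemma sphere_area_eq_Gamma:
  assumes "n > 0"
  shows "sphere_area n = 2 * pi powr (real n / 2) / Gamma (real n / 2)"
proof -
  have *: "Gamma (real n / 2 + 1) = real n / 2 * Gamma (real n / 2)"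
    using assms by (subst Gamma_plus1) (auto elim!: nonpos_Ints_cases)
  moreover have "Gamma (real n / 2) > 0"
    using assms by (intro Gamma_real_pos) auto
  ultimately show ?thesis
    using assms unfolding sphere_area_def unit_ball_vol_def * by simp
qed

lemma sphere_area_has_derivative:
  "((\<lambda>r. measure lborel (ball (0::'a::euclidean_space) r)) has_real_derivative
     sphere_area DIM('a)) (at 1)"
proof -
  have "((\<lambda>r. unit_ball_vol (real DIM('a)) * r ^ DIM('a)) has_real_derivative
     sphere_area DIM('a)) (at 1)"
    by (auto intro!: derivative_eq_intros simp: sphere_area_def)
  moreover have "\<forall>\<^sub>F r in nhds (1::real). r > 0"
    using eventually_nhds_in_open[of "{0<..}" "1::real"] by simp
  hence "\<forall>\<^sub>F r in nhds 1. measure lborel (ball (0::'a) r) =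
      unit_ball_vol (real DIM('a)) * r ^ DIM('a)"
    by eventually_elim (simp add: content_ball)
  ultimately show ?thesis
    by (subst DERIV_cong_ev[OF refl _ refl])
qed

end

theory Submission
  imports Defs
begin

text \<open>
  Put \<open>r = norm x\<close>, \<open>T = a\<^sub>N * r\<close>, \<open>\<delta> = a\<^sub>N / a\<^sub>N\<^sub>-\<^sub>1\<close> and \<open>d = N - 1\<close>.

  The inner integral depends only on \<open>r\<close>. For a Haar random rotation \<open>k\<close> the point \<open>k x\<close> is uniformly
  distributed on the sphere of radius \<open>r\<close>, and so is \<open>(r / norm y) y\<close> for a uniform point \<open>y\<close> of the unit ball.
  Hence the inner integral is the volume of the set of those \<open>y\<close> in the unit ball \<open>B\<close> with
  \<open>r * norm (a y) < norm y\<close>, divided by the volume of \<open>B\<close> (\<open>nn_integral_orbit\<close>,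
  \<open>expectation_ball_eq_needle\<close>). Written out, the condition is
  \<open>\<Sum>i<N. ((a\<^sub>i r)\<^sup>2 - 1) y\<^sub>i\<^sup>2 < (1 - T\<^sup>2) y\<^sub>N\<^sup>2\<close>. If \<open>T > \<delta>\<close>, all coefficients on the left are positive and
  this is an elliptic cone around the last axis; if \<open>T \<ge> 1\<close>, it is empty.

  A double cone of height \<open>1\<close> on an ellipsoid has an explicit volume (\<open>measure_elliptic_cone\<close>). Since
  \<open>det a = 1\<close>, neglecting the terms \<open>- 1\<close> in the coefficients gives the volume \<open>\<kappa> a\<^sub>N\<^sup>N (sqrt (1 - T\<^sup>2) / T)\<^sup>d\<close> for it,
  with \<open>\<kappa> = 2 vol(B\<^sub>d) / N\<close>. Both this neglect and the replacement of the spherical end of the cone by a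
  flat one cost a relative error of order \<open>(\<delta> / T)\<^sup>2\<close> when \<open>T \<ge> 2 \<delta>\<close> (\<open>needle_bounds\<close>). For smaller \<open>T\<close> the volume
  is still at most a constant times \<open>a\<^sub>N\<^sup>N / T\<^sup>d\<close>, by comparison with a box (\<open>needle_crude_bound\<close>). Altogether the error
  is at most a constant times \<open>a\<^sub>N\<^sup>N T\<^sup>-\<^sup>d (\<delta> / T) powr (2/3)\<close> (\<open>needle_approx\<close>).

  It remains to integrate against \<open>\<nu>\<close>. A radial function is an integral of indicators of balls, so
  that its integral is an integral of ball masses (\<open>layer_cake\<close>). For \<open>(sqrt (1 - T\<^sup>2) / T)\<^sup>d\<close> this yields
  the main term exactly (\<open>nn_integral_profile\<close>), because the derivative of that function is
  \<open>- d (1 - T\<^sup>2) powr ((N - 3) / 2) / T\<^sup>N\<close>; the constants match since \<open>sphere_area n = n vol(B\<^sub>n)\<close>. For the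
  error, the bound \<open>M(\<nu>) R\<^sup>N\<close> on ball masses reduces the integral to that of \<open>\<tau> powr (- (2/3))\<close> near \<open>0\<close>,
  which converges (\<open>nn_integral_singular_power_le\<close>).
\<close>

section \<open>Haar measure on the rotation group and uniform points of a sphere\<close>

lemma measurable_matrix_ops [measurable]:
  fixes f g :: "'a \<Rightarrow> real^'n^'n"
  assumes [measurable]: "f \<in> borel_measurable M" "g \<in> borel_measurable M"
  shows "(\<lambda>x. f x ** g x) \<in> borel_measurable M"
    and "(\<lambda>x. transpose (f x)) \<in> borel_measurable M"
proof -
  have "continuous_on UNIV (\<lambda>p::(real^'n^'n)\<times>(real^'n^'n). fst p ** snd p)"
    unfolding matrix_matrix_mult_def by (intro continuous_intros)
  then show "(\<lambda>x. f x ** g x) \<in> borel_measurable M"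
    by (rule borel_measurable_continuous_Pair[OF assms])
  have "continuous_on UNIV (transpose :: real^'n^'n \<Rightarrow> _)"
    unfolding transpose_def by (intro continuous_intros)
  then show "(\<lambda>x. transpose (f x)) \<in> borel_measurable M"
    using borel_measurable_continuous_on assms(1) by blast
qed

lemma measurable_matrix_vector_mult [measurable]:
  fixes f :: "'a \<Rightarrow> real^'n^'n"
  assumes [measurable]: "f \<in> borel_measurable M" "g \<in> borel_measurable M"
  shows "(\<lambda>x. f x *v g x) \<in> borel_measurable M"
proof -
  have "continuous_on UNIV (\<lambda>p::(real^'n^'n)\<times>(real^'n). fst p *v snd p)"
    unfolding matrix_vector_mult_def by (intro continuous_intros)
  then show ?thesis
    by (rule borel_measurable_continuous_Pair[OF assms])
qed

lemma SO_transpose: "k \<in> SO \<Longrightarrow> transpose k \<in> SO"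
  by (simp add: SO_def rotation_matrix_def orthogonal_matrix_transpose)

lemma SO_mult: "g \<in> SO \<Longrightarrow> k \<in> SO \<Longrightarrow> g ** k \<in> SO"
  by (simp add: SO_def rotation_matrix_def orthogonal_matrix_mul det_mul)

lemma orthogonal_transformation_SO:
  "k \<in> SO \<Longrightarrow> orthogonal_transformation ((*v) (k::real^'n^'n))"
  by (simp add: SO_def rotation_matrix_def orthogonal_transformation_matrix matrix_vector_mul_linear)

locale Haar_SO =
  fixes m :: "(real^'n^'n) measure"
  assumes Haar: "normalized_Haar_SO m"
begin

sublocale prob_space m
  using Haar by (simp add: normalized_Haar_SO_def)

lemma space_Haar: "space m = SO"
  using Haar sets_eq_imp_space_eq[of m "restrict_space borel SO"]
  by (simp add: normalized_Haar_SO_def space_restrict_space)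

lemma measurable_Haar [measurable]: "(\<lambda>k. k) \<in> borel_measurable m"
  using Haar by (subst measurable_cong_sets[of m "restrict_space borel SO"])
    (auto simp: normalized_Haar_SO_def intro: measurable_restrict_space1)

lemma borel_measurable_HaarI: "f \<in> borel_measurable borel \<Longrightarrow> f \<in> borel_measurable m"
  by (rule measurable_compose[OF measurable_Haar])

lemma nn_integral_left_mult:
  assumes "g \<in> SO" and [measurable]: "f \<in> borel_measurable borel"
  shows "(\<integral>\<^sup>+k. f (g ** k) \<partial>m) = (\<integral>\<^sup>+k. f k \<partial>m)"
proof -
  have *: "(\<lambda>k. g ** k) \<in> m \<rightarrow>\<^sub>M m"
  proof (subst measurable_cong_sets[OF refl, of m "restrict_space borel SO"])
    show "sets m = sets (restrict_space borel SO)"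
      using Haar by (simp add: normalized_Haar_SO_def)
    show "(\<lambda>k. g ** k) \<in> m \<rightarrow>\<^sub>M restrict_space borel SO"
      by (rule measurable_restrict_space2) (auto simp: space_Haar SO_mult assms(1))
  qed
  have "(\<integral>\<^sup>+k. f k \<partial>m) = (\<integral>\<^sup>+k. f k \<partial>distr m m (\<lambda>k. g ** k))"
    using Haar assms(1) by (simp add: normalized_Haar_SO_def)
  also have "\<dots> = (\<integral>\<^sup>+k. f (g ** k) \<partial>m)"
    using * by (subst nn_integral_distr) (auto intro: borel_measurable_HaarI)
  finally show ?thesis ..
qed

text \<open>
Inversion preserves the measure although only left invariance is assumed. In the double integral
of \<open>f (h\<^sup>-\<^sup>1 k)\<close>, left invariance in \<open>k\<close> removes \<open>h\<close> and leaves the integral of \<open>f\<close>, whereas left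
invariance in \<open>h\<close>, applied to \<open>h\<^sup>-\<^sup>1 k = (k\<^sup>-\<^sup>1 h)\<^sup>-\<^sup>1\<close>, removes \<open>k\<close> and leaves the integral of
\<open>h \<mapsto> f (h\<^sup>-\<^sup>1)\<close>.
\<close>

lemma nn_integral_transpose:
  assumes [measurable]: "f \<in> borel_measurable borel"
  shows "(\<integral>\<^sup>+k. f (transpose k) \<partial>m) = (\<integral>\<^sup>+k. f k \<partial>m)"
proof -
  interpret pair_sigma_finite m m ..
  have "(\<integral>\<^sup>+k. f (transpose k) \<partial>m) = (\<integral>\<^sup>+k. \<integral>\<^sup>+h. f (transpose h) \<partial>m \<partial>m)"
    by (simp add: emeasure_space_1)
  also have "\<dots> = (\<integral>\<^sup>+k. \<integral>\<^sup>+h. f (transpose h ** k) \<partial>m \<partial>m)"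
  proof (rule nn_integral_cong)
    fix k assume "k \<in> space m"
    then have "transpose k \<in> SO" by (simp add: space_Haar SO_transpose)
    from nn_integral_left_mult[OF this, of "\<lambda>h. f (transpose h)"]
    show "(\<integral>\<^sup>+h. f (transpose h) \<partial>m) = (\<integral>\<^sup>+h. f (transpose h ** k) \<partial>m)"
      by (simp add: matrix_transpose_mul)
  qed
  also have "\<dots> = (\<integral>\<^sup>+h. \<integral>\<^sup>+k. f (transpose h ** k) \<partial>m \<partial>m)"
    by (rule Fubini') measurable
  also have "\<dots> = (\<integral>\<^sup>+h. \<integral>\<^sup>+k. f k \<partial>m \<partial>m)"
    by (rule nn_integral_cong, rule nn_integral_left_mult) (auto simp: space_Haar SO_transpose)
  also have "\<dots> = (\<integral>\<^sup>+k. f k \<partial>m)"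
    by (simp add: emeasure_space_1)
  finally show ?thesis .
qed

lemma nn_integral_right_mult:
  assumes "g \<in> SO" and [measurable]: "f \<in> borel_measurable borel"
  shows "(\<integral>\<^sup>+k. f (k ** g) \<partial>m) = (\<integral>\<^sup>+k. f k \<partial>m)"
proof -
  have "(\<integral>\<^sup>+k. f (k ** g) \<partial>m) = (\<integral>\<^sup>+k. f (transpose k ** g) \<partial>m)"
    using nn_integral_transpose[of "\<lambda>k. f (k ** g)"] by simp
  also have "\<dots> = (\<integral>\<^sup>+k. f (transpose (transpose g ** k)) \<partial>m)"
    by (simp add: matrix_transpose_mul)
  also have "\<dots> = (\<integral>\<^sup>+k. f k \<partial>m)"
    using nn_integral_left_mult[OF SO_transpose[OF assms(1)], of "\<lambda>k. f (transpose k)"]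
      nn_integral_transpose[of f] by simp
  finally show ?thesis .
qed

text \<open>
The group acts transitively on each sphere, so that \<open>x = g y\<close> with a rotation \<open>g\<close>; right
invariance then absorbs \<open>g\<close>.
\<close>

lemma nn_integral_orbit_cong:
  fixes x y :: "real^'n"
  assumes "2 \<le> CARD('n)" "norm x = norm y" and [measurable]: "f \<in> borel_measurable borel"
  shows "(\<integral>\<^sup>+k. f (k *v x) \<partial>m) = (\<integral>\<^sup>+k. f (k *v y) \<partial>m)"
proof -
  obtain F where F: "orthogonal_transformation F" "det (matrix F) = 1" "F y = x"
    using rotation_exists[OF assms(1), of y x] assms(2) by metis
  have lin: "linear F" using F(1) by (simp add: orthogonal_transformation_linear)
  then have Fm: "F z = matrix F *v z" for z by (simp add: matrix_works)
  have "matrix F \<in> SO"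
    using F lin by (simp add: SO_def rotation_matrix_def orthogonal_transformation_matrix)
  then have "(\<integral>\<^sup>+k. f ((k ** matrix F) *v y) \<partial>m) = (\<integral>\<^sup>+k. f (k *v y) \<partial>m)"
    by (rule nn_integral_right_mult[where f="\<lambda>k. f (k *v y)"]) measurable
  moreover have "k *v x = (k ** matrix F) *v y" for k :: "real^'n^'n"
    using F(3) Fm[of y] by (simp add: matrix_vector_mul_assoc[symmetric])
  ultimately show ?thesis by simp
qed

end

lemma nn_integral_lborel_translate:
  fixes f :: "'a::euclidean_space \<Rightarrow> ennreal"
  assumes [measurable]: "f \<in> borel_measurable borel"
  shows "(\<integral>\<^sup>+x. f (c + x) \<partial>lborel) = (\<integral>\<^sup>+x. f x \<partial>lborel)"
proof -
  have "(\<integral>\<^sup>+x. f x \<partial>lborel) = (\<integral>\<^sup>+x. f x \<partial>distr lborel borel ((+) c))"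
    by (simp add: lborel_distr_plus)
  then show ?thesis by (simp add: nn_integral_distr)
qed

text \<open>
The image of Lebesgue measure under \<open>F\<close> is again translation invariant, so that the usual
uniqueness argument applies: compute the integral of \<open>f x * g (x + F y)\<close> over all \<open>x, y\<close> in both
orders. With \<open>f\<close> the indicator of the unit ball, which \<open>F\<close> preserves, both orders give the volume
of the ball times an integral of \<open>g\<close>, once with and once without \<open>F\<close>.
\<close>

lemma nn_integral_lborel_orthogonal:
  fixes F :: "'a::euclidean_space \<Rightarrow> 'a"
  assumes F: "orthogonal_transformation F" and [measurable]: "g \<in> borel_measurable borel"
  shows "(\<integral>\<^sup>+x. g (F x) \<partial>lborel) = (\<integral>\<^sup>+x. g x \<partial>lborel)"
proof -
  have lin: "linear F" using F by (simp add: orthogonal_transformation_linear)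
  then have [measurable]: "F \<in> borel_measurable borel"
    by (intro borel_measurable_continuous_onI linear_continuous_on) (simp add: linear_conv_bounded_linear)
  have surj: "surj F" using F by (simp add: orthogonal_transformation_surj)
  define f where "f = (indicator (ball 0 1) :: 'a \<Rightarrow> ennreal)"
  have [measurable]: "f \<in> borel_measurable borel" unfolding f_def
    by (intro borel_measurable_indicator borel_open open_ball)
  define v where "v = emeasure lborel (ball (0::'a) 1)"
  have vf: "(\<integral>\<^sup>+x. f x \<partial>lborel) = v" unfolding f_def v_def by simp
  have v: "v \<noteq> 0" "v \<noteq> \<infinity>" 
    unfolding v_def using unit_ball_vol_pos[of "real DIM('a)"]
    by (simp_all add: emeasure_ball less_imp_neq[symmetric])
  have "v * (\<integral>\<^sup>+x. g (F x) \<partial>lborel) = (\<integral>\<^sup>+x. f x * (\<integral>\<^sup>+y. g (F y) \<partial>lborel) \<partial>lborel)"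
    by (simp add: nn_integral_multc vf)
  also have "\<dots> = (\<integral>\<^sup>+x. \<integral>\<^sup>+y. f x * g (x + F y) \<partial>lborel \<partial>lborel)"
  proof (rule nn_integral_cong)
    fix x
    obtain z where z: "x = F z" using surj by (metis surjD)
    have "(\<integral>\<^sup>+y. g (x + F y) \<partial>lborel) = (\<integral>\<^sup>+y. g (F (z + y)) \<partial>lborel)"
      using lin by (simp add: z linear_add)
    also have "\<dots> = (\<integral>\<^sup>+y. g (F y) \<partial>lborel)"
      by (rule nn_integral_lborel_translate[where f="\<lambda>y. g (F y)"]) measurable
    finally show "f x * (\<integral>\<^sup>+y. g (F y) \<partial>lborel) = (\<integral>\<^sup>+y. f x * g (x + F y) \<partial>lborel)"
      by (simp add: nn_integral_cmult)
  qed
  also have "\<dots> = (\<integral>\<^sup>+y. \<integral>\<^sup>+x. f x * g (x + F y) \<partial>lborel \<partial>lborel)"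
    by (rule lborel_pair.Fubini') measurable
  also have "\<dots> = (\<integral>\<^sup>+y. \<integral>\<^sup>+x. f (x - F y) * g x \<partial>lborel \<partial>lborel)"
  proof (rule nn_integral_cong)
    fix y
    show "(\<integral>\<^sup>+x. f x * g (x + F y) \<partial>lborel) = (\<integral>\<^sup>+x. f (x - F y) * g x \<partial>lborel)"
      using nn_integral_lborel_translate[of "\<lambda>x. f (x - F y) * g x" "F y"]
      by (simp add: add.commute)
  qed
  also have "\<dots> = (\<integral>\<^sup>+x. \<integral>\<^sup>+y. f (x - F y) * g x \<partial>lborel \<partial>lborel)"
    by (rule lborel_pair.Fubini') measurable
  also have "\<dots> = (\<integral>\<^sup>+x. v * g x \<partial>lborel)"
  proof (rule nn_integral_cong)
    fix x
    obtain z where z: "x = F z" using surj by (metis surjD)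
    have "f (x - F y) = indicator (ball z 1) y" for y
      using F lin by (simp add: z f_def indicator_def dist_norm linear_diff[symmetric] orthogonal_transformation_norm)
    then have "(\<integral>\<^sup>+y. f (x - F y) * g x \<partial>lborel) = (\<integral>\<^sup>+y. indicator (ball z 1) y * g x \<partial>lborel)"
      by simp
    also have "\<dots> = emeasure lborel (ball z 1) * g x"
      by (subst nn_integral_multc) (auto intro!: borel_measurable_indicator borel_open)
    also have "emeasure lborel (ball z 1) = v"
      by (simp add: v_def emeasure_ball)
    finally show "(\<integral>\<^sup>+y. f (x - F y) * g x \<partial>lborel) = v * g x" .
  qed
  also have "\<dots> = v * (\<integral>\<^sup>+x. g x \<partial>lborel)" by (simp add: nn_integral_cmult)
  finally show ?thesis using v by (simp add: ennreal_mult_cancel_left)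
qed

text \<open>
A Haar random rotation moves \<open>x\<close> to a uniformly distributed point of its sphere. The uniform
distribution is expressed by a uniform point \<open>y\<close> of the unit ball, projected radially to the sphere,
so that no surface measure is needed. Replacing \<open>x\<close> by the projection of \<open>y\<close> changes nothing on the
left, and after Fubini each rotation disappears by the rotation invariance of Lebesgue measure.
\<close>

lemma (in Haar_SO) nn_integral_orbit:
  fixes x :: "real^'n"
  assumes "2 \<le> CARD('n)" and [measurable]: "f \<in> borel_measurable borel"
  shows "(\<integral>\<^sup>+k. f (k *v x) \<partial>m) * emeasure lborel (ball 0 1 :: (real^'n) set) =
         (\<integral>\<^sup>+y. f ((norm x / norm y) *\<^sub>R y) * indicator (ball 0 1) y \<partial>lborel)"
proof -
  interpret pair_sigma_finite m "lborel :: (real^'n) measure" ..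
  define g where "g y = f ((norm x / norm y) *\<^sub>R y) * indicator (ball 0 1) y" for y
  have [measurable]: "ball 0 1 \<in> sets (borel :: (real^'n) measure)" by simp
  have g[measurable]: "g \<in> borel_measurable borel" unfolding g_def by measurable
  have "(\<integral>\<^sup>+k. f (k *v x) \<partial>m) * emeasure lborel (ball 0 1 :: (real^'n) set)
     = (\<integral>\<^sup>+y. (\<integral>\<^sup>+k. f (k *v x) \<partial>m) * indicator (ball 0 1 :: (real^'n) set) y \<partial>lborel)"
    by (subst nn_integral_cmult) auto
  also have "\<dots> = (\<integral>\<^sup>+y. \<integral>\<^sup>+k. g (k *v y) \<partial>m \<partial>lborel)"
  proof (rule nn_integral_cong_AE)
    have "AE y in lborel. y \<notin> {0::real^'n}"
      by (intro AE_not_in) auto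
    then show "AE y in lborel. (\<integral>\<^sup>+k. f (k *v x) \<partial>m) * indicator (ball 0 1 :: (real^'n) set) y
       = (\<integral>\<^sup>+k. g (k *v y) \<partial>m)"
    proof eventually_elim
      case (elim y)
      have "(\<integral>\<^sup>+k. g (k *v y) \<partial>m) =
          (\<integral>\<^sup>+k. f (k *v ((norm x / norm y) *\<^sub>R y)) * indicator (ball 0 1) y \<partial>m)"
      proof (rule nn_integral_cong)
        fix k assume "k \<in> space m"
        then have "norm (k *v y) = norm y"
          by (simp add: space_Haar orthogonal_transformation_SO orthogonal_transformation_norm)
        then show "g (k *v y) = f (k *v ((norm x / norm y) *\<^sub>R y)) * indicator (ball 0 1) y"
          by (simp add: g_def indicator_def matrix_vector_mult_scaleR)
      qed
      also have "\<dots> = (\<integral>\<^sup>+k. f (k *v ((norm x / norm y) *\<^sub>R y)) \<partial>m) * indicator (ball 0 1) y"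
        by (rule nn_integral_multc) measurable
      also have "(\<integral>\<^sup>+k. f (k *v ((norm x / norm y) *\<^sub>R y)) \<partial>m) = (\<integral>\<^sup>+k. f (k *v x) \<partial>m)"
        using elim assms(1) by (intro nn_integral_orbit_cong) auto
      finally show ?case by simp
    qed
  qed
  also have "\<dots> = (\<integral>\<^sup>+k. \<integral>\<^sup>+y. g (k *v y) \<partial>lborel \<partial>m)"
    by (rule Fubini') measurable
  also have "\<dots> = (\<integral>\<^sup>+k. \<integral>\<^sup>+y. g y \<partial>lborel \<partial>m)"
  proof (rule nn_integral_cong)
    fix k assume "k \<in> space m"
    then show "(\<integral>\<^sup>+y. g (k *v y) \<partial>lborel) = (\<integral>\<^sup>+y. g y \<partial>lborel)"
      by (intro nn_integral_lborel_orthogonal orthogonal_transformation_SO) (auto simp: space_Haar)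
  qed
  also have "\<dots> = (\<integral>\<^sup>+y. g y \<partial>lborel)"
    by (simp add: emeasure_space_1)
  finally show ?thesis unfolding g_def .
qed

section \<open>Volumes of elliptic cones\<close>

lemma lborel_vec_eq_PiM:
  "(lborel :: (real^'n) measure) = distr (Pi\<^sub>M UNIV (\<lambda>_. lborel)) borel vec_lambda"
proof (rule lborel_eqI)
  interpret product_sigma_finite "\<lambda>_::'n. lborel :: real measure" ..
  have m [measurable]: "vec_lambda \<in> Pi\<^sub>M UNIV (\<lambda>_::'n. lborel) \<rightarrow>\<^sub>M (borel :: (real^'n) measure)"
    by (subst borel_measurable_euclidean_space) (auto simp: Basis_vec_def inner_axis)
  have Basis_eq: "(\<Prod>b\<in>Basis. h b) = (\<Prod>i\<in>UNIV. h (axis i 1))" for h :: "real^'n \<Rightarrow> real"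
  proof -
    have B: "Basis = range (\<lambda>i::'n. axis i (1::real))" by (auto simp: Basis_vec_def)
    show ?thesis by (subst B, subst prod.reindex) (auto simp: inj_on_def axis_eq_axis)
  qed
  fix l u :: "real^'n" assume le: "\<And>b. b \<in> Basis \<Longrightarrow> l \<bullet> b \<le> u \<bullet> b"
  have le': "l $ i \<le> u $ i" for i
    using le[of "axis i 1"] by (simp add: inner_axis)
  have "vec_lambda -` box l u \<inter> space (Pi\<^sub>M UNIV (\<lambda>_::'n. lborel)) = (\<Pi>\<^sub>E i\<in>UNIV. {l$i<..<u$i})"
    by (auto simp: space_PiM mem_box_cart PiE_iff)
  then have "emeasure (distr (Pi\<^sub>M UNIV (\<lambda>_. lborel)) borel vec_lambda) (box l u) =
      emeasure (Pi\<^sub>M UNIV (\<lambda>_::'n. lborel)) (\<Pi>\<^sub>E i\<in>UNIV. {l$i<..<u$i})"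
    by (simp add: emeasure_distr)
  also have "\<dots> = (\<Prod>i\<in>UNIV. ennreal (u$i - l$i))"
    using le' by (subst emeasure_PiM) auto
  also have "\<dots> = ennreal (\<Prod>b\<in>Basis. (u - l) \<bullet> b)"
    using le' by (simp add: prod_ennreal Basis_eq inner_axis)
  finally show "emeasure (distr (Pi\<^sub>M UNIV (\<lambda>_. lborel)) borel vec_lambda) (box l u) =
      ennreal (\<Prod>b\<in>Basis. (u - l) \<bullet> b)" .
qed simp

text \<open>
The section of the cone below is an open ball whose dimension is one less than that of the
ambient type, hence is not the cardinality of a type at hand. Products over an arbitrary finite
index set avoid the problem. The closed ball is known, and its volume is continuous in the radius.
\<close>

lemma emeasure_PiM_open_ball:
  assumes "finite A" "r > 0"
  shows "emeasure (Pi\<^sub>M A (\<lambda>_. lborel)) {f \<in> space (Pi\<^sub>M A (\<lambda>_. lborel)). (\<Sum>i\<in>A. (f i)\<^sup>2) < r\<^sup>2} =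
    ennreal (unit_ball_vol (real (card A)) * r ^ card A)" (is "emeasure ?M ?U = ?v r")
proof (rule antisym)
  let ?B = "\<lambda>r. {f. sqrt (\<Sum>i\<in>A. (f i)\<^sup>2) \<le> r} \<inter> space ?M"
  have [measurable]: "?U \<in> sets ?M" "?B s \<in> sets ?M" for s
    using assms(1) by measurable
  have "emeasure ?M ?U \<le> emeasure ?M (?B r)"
    using assms(2) by (intro emeasure_mono) (auto intro!: real_le_lsqrt simp: sum_nonneg less_imp_le)
  then show "emeasure ?M ?U \<le> ?v r"
    using emeasure_cball_aux[OF assms] by simp
  have "((\<lambda>s. ?v s) \<longlongrightarrow> ?v r) (at_left r)"
    by (intro tendsto_intros)
  moreover have "\<forall>\<^sub>F s in at_left r. ?v s \<le> emeasure ?M ?U"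
  proof -
    have "\<forall>\<^sub>F s in at_left r. s \<in> {0<..<r}"
      using assms(2) by (rule eventually_at_left_real)
    then show ?thesis
    proof eventually_elim
      case (elim s)
      have "?B s \<subseteq> ?U"
      proof safe
        fix f assume "sqrt (\<Sum>i\<in>A. (f i)\<^sup>2) \<le> s"
        then have "(\<Sum>i\<in>A. (f i)\<^sup>2) \<le> s\<^sup>2" by (rule sqrt_le_D)
        also have "\<dots> < r\<^sup>2" using elim by (intro power_strict_mono) auto
        finally show "(\<Sum>i\<in>A. (f i)\<^sup>2) < r\<^sup>2" .
      qed
      then have "emeasure ?M (?B s) \<le> emeasure ?M ?U" by (intro emeasure_mono) auto
      then show ?case using emeasure_cball_aux[OF assms(1), of s] elim by simp
    qed
  qed
  ultimately show "?v r \<le> emeasure ?M ?U"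
    by (rule tendsto_upperbound) simp
qed

lemma nn_integral_abs_power:
  "(\<integral>\<^sup>+t. ennreal (\<bar>t\<bar> ^ d) * indicator {-1..1} t \<partial>lborel) = ennreal (2 / (real d + 1))"
proof -
  have 1: "((\<lambda>t::real. t ^ d) has_integral (1 / (real d + 1))) {0..1}"
  proof -
    have "((\<lambda>t. t ^ Suc d / (real d + 1)) has_vector_derivative t ^ d) (at t within {0..1})" for t :: real
      unfolding has_real_derivative_iff_has_vector_derivative[symmetric]
      by (auto intro!: derivative_eq_intros simp: add.commute simp del: power_Suc)
    from fundamental_theorem_of_calculus[OF _ this] show ?thesis by fastforce
  qed
  then have "((\<lambda>t::real. (- t) ^ d) has_integral (1 / (real d + 1))) {-1..0}"
    using has_integral_reflect_real[of "\<lambda>t. t ^ d" _ 1 0] by simp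
  then have "((\<lambda>t::real. \<bar>t\<bar> ^ d) has_integral (1 / (real d + 1))) {-1..0}"
    by (rule has_integral_eq[rotated]) auto
  moreover have "((\<lambda>t::real. \<bar>t\<bar> ^ d) has_integral (1 / (real d + 1))) {0..1}"
    by (rule has_integral_eq[OF _ 1]) auto
  ultimately have "((\<lambda>t::real. \<bar>t\<bar> ^ d) has_integral (1 / (real d + 1) + 1 / (real d + 1))) {-1..1}"
    by (rule has_integral_combine[rotated 2]) auto
  then show ?thesis
    by (subst nn_integral_has_integral_lebesgue') auto
qed

definition unit_cone :: "'n::finite \<Rightarrow> (real^'n) set" where
  "unit_cone l = {y. (\<Sum>i\<in>-{l}. (y $ i)\<^sup>2) < (y $ l)\<^sup>2 \<and> \<bar>y $ l\<bar> < 1}"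

lemma open_unit_cone: "open (unit_cone l)"
  unfolding unit_cone_def by (intro open_Collect_conj open_Collect_less continuous_intros)

definition unit_cone_vol :: "nat \<Rightarrow> real" where
  "unit_cone_vol n = 2 * unit_ball_vol (real (n - 1)) / real n"

lemma unit_cone_vol_nonneg [simp]: "unit_cone_vol n \<ge> 0"
  by (simp add: unit_cone_vol_def)

text \<open>
Slicing orthogonally to the axis \<open>l\<close>, the section at height \<open>t\<close> is a ball of radius \<open>\<bar>t\<bar>\<close>.
\<close>

lemma emeasure_unit_cone:
  fixes l :: "'n::finite"
  assumes "CARD('n) \<ge> 2"
  shows "emeasure lborel (unit_cone l :: (real^'n) set) =
    ennreal (unit_cone_vol CARD('n))"
proof -
  interpret product_sigma_finite "\<lambda>_::'n. lborel :: real measure" ..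
  let ?A = "-{l}" and ?M = "\<lambda>A. Pi\<^sub>M A (\<lambda>_::'n. lborel :: real measure)"
  let ?w = "unit_ball_vol (real (card ?A))"
  have card: "card ?A = CARD('n) - 1"
    by (simp add: Compl_eq_Diff_UNIV)
  have [measurable]: "unit_cone l \<in> sets borel" using open_unit_cone by (rule borel_open)
  have vm [measurable]: "vec_lambda \<in> ?M (insert l ?A) \<rightarrow>\<^sub>M (borel :: (real^'n) measure)"
  proof -
    have "insert l ?A = UNIV" by auto
    then show ?thesis
      by (subst borel_measurable_euclidean_space) (auto simp: Basis_vec_def inner_axis)
  qed
  have "emeasure lborel (unit_cone l :: (real^'n) set) = (\<integral>\<^sup>+x. indicator (unit_cone l) x \<partial>lborel)"
    by simp
  also have "\<dots> = (\<integral>\<^sup>+f. indicator (unit_cone l) (vec_lambda f) \<partial>?M (insert l ?A))"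
  proof -
    have "insert l ?A = UNIV" by auto
    moreover have "vec_lambda \<in> ?M UNIV \<rightarrow>\<^sub>M (borel :: (real^'n) measure)"
      using \<open>insert l ?A = UNIV\<close> vm by simp
    ultimately show ?thesis
      by (subst lborel_vec_eq_PiM) (simp add: nn_integral_distr del: nn_integral_indicator)
  qed
  also have "\<dots> = (\<integral>\<^sup>+t. \<integral>\<^sup>+g. indicator (unit_cone l) (vec_lambda (g(l := t))) \<partial>?M ?A \<partial>lborel)"
    by (rule product_nn_integral_insert_rev) auto
  also have "\<dots> = (\<integral>\<^sup>+t. ennreal ?w * (ennreal (\<bar>t\<bar> ^ card ?A) * indicator {-1..1} t) \<partial>lborel)"
  proof (rule nn_integral_cong_AE)
    have "AE t in lborel. t \<notin> {-1, 0, 1::real}"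
      by (intro AE_not_in countable_imp_null_set_lborel) auto
    then show "AE t in lborel. (\<integral>\<^sup>+g. indicator (unit_cone l) (vec_lambda (g(l := t))) \<partial>?M ?A)
        = ennreal ?w * (ennreal (\<bar>t\<bar> ^ card ?A) * indicator {-1..1} t)"
    proof eventually_elim
      case (elim t)
      let ?U = "{f \<in> space (?M ?A). (\<Sum>i\<in>?A. (f i)\<^sup>2) < \<bar>t\<bar>\<^sup>2}"
      have [measurable]: "?U \<in> sets (?M ?A)" by measurable
      have eq: "indicator (unit_cone l) (vec_lambda (g(l := t))) = (indicator ?U g * indicator {-1..1} t :: ennreal)"
        if "g \<in> space (?M ?A)" for g
        using that elim by (auto simp: unit_cone_def indicator_def)
      have "(\<integral>\<^sup>+g. indicator (unit_cone l) (vec_lambda (g(l := t))) \<partial>?M ?A)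
        = (\<integral>\<^sup>+g. indicator ?U g * indicator {-1..1} t \<partial>?M ?A)"
        by (rule nn_integral_cong) (rule eq)
      also have "\<dots> = emeasure (?M ?A) ?U * indicator {-1..1} t"
        by (subst nn_integral_multc) auto
      also have "emeasure (?M ?A) ?U = ennreal (?w * \<bar>t\<bar> ^ card ?A)"
        using elim by (intro emeasure_PiM_open_ball) auto
      finally show ?case by (simp add: ennreal_mult mult.assoc del: fun_upd_apply)
    qed
  qed
  also have "\<dots> = ennreal ?w * ennreal (2 / (real (card ?A) + 1))"
    by (subst nn_integral_cmult) (auto simp: nn_integral_abs_power)
  also have "\<dots> = ennreal (?w * (2 / (real (card ?A) + 1)))"
    by (subst ennreal_mult) auto
  also have "?w * (2 / (real (card ?A) + 1)) = unit_cone_vol CARD('n)"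
    using assms by (simp add: card of_nat_diff unit_cone_vol_def)
  finally show ?thesis .
qed

definition elliptic_cone :: "'n::finite \<Rightarrow> ('n \<Rightarrow> real) \<Rightarrow> real \<Rightarrow> real \<Rightarrow> (real^'n) set" where
  "elliptic_cone l b c s = {y. (\<Sum>i\<in>-{l}. b i * (y $ i)\<^sup>2) < c * (y $ l)\<^sup>2 \<and> \<bar>y $ l\<bar> < s}"

lemma open_elliptic_cone: "open (elliptic_cone l b c s)"
  unfolding elliptic_cone_def by (intro open_Collect_conj open_Collect_less continuous_intros)

text \<open>
Scaling the coordinates by \<open>m\<close> turns both defining inequalities of the unit cone into those of
the elliptic cone.
\<close>

lemma elliptic_cone_eq_stretch:
  fixes l :: "'n::finite"
  assumes b: "\<And>i. i \<noteq> l \<Longrightarrow> b i > 0" and "c > 0" "s > 0"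
  defines "m \<equiv> \<lambda>i. if i = l then s else s * sqrt (c / b i)"
  shows "elliptic_cone l b c s = (\<lambda>x. \<chi> i. m i * x $ i) ` unit_cone l"
proof -
  have m: "m i > 0" for i using assms by (auto simp: m_def)
  have *: "(\<chi> i. m i * x $ i) \<in> elliptic_cone l b c s \<longleftrightarrow> x \<in> unit_cone l" for x :: "real^'n"
  proof -
    have "b i * (m i * x $ i)\<^sup>2 = (c * s\<^sup>2) * (x $ i)\<^sup>2" if "i \<noteq> l" for i
      using that b[OF that] assms(2) by (simp add: m_def power_mult_distrib real_sqrt_divide power_divide)
    then have "(\<Sum>i\<in>-{l}. b i * (m i * x $ i)\<^sup>2) = (c * s\<^sup>2) * (\<Sum>i\<in>-{l}. (x $ i)\<^sup>2)"
      by (simp add: sum_distrib_left)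
    moreover have "c * (m l * x $ l)\<^sup>2 = (c * s\<^sup>2) * (x $ l)\<^sup>2"
      by (simp add: m_def power_mult_distrib)
    moreover have "\<bar>m l * x $ l\<bar> < s \<longleftrightarrow> \<bar>x $ l\<bar> < 1"
      using assms(3) by (simp add: m_def abs_mult)
    ultimately show ?thesis
      using assms(2,3) by (simp add: elliptic_cone_def unit_cone_def)
  qed
  show ?thesis
  proof safe
    fix y assume "y \<in> elliptic_cone l b c s"
    moreover have y: "y = (\<chi> i. m i * (\<chi> i. y $ i / m i) $ i)"
      using m by (simp add: vec_eq_iff less_imp_neq[symmetric])
    ultimately have "(\<chi> i. y $ i / m i) \<in> unit_cone l"
      using *[of "\<chi> i. y $ i / m i"] by metis
    with y show "y \<in> (\<lambda>x. \<chi> i. m i * x $ i) ` unit_cone l"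
      by (rule image_eqI)
  qed (use * in auto)
qed

lemma measure_elliptic_cone:
  fixes l :: "'n::finite"
  assumes "CARD('n) \<ge> 2" and b: "\<And>i. i \<noteq> l \<Longrightarrow> b i > 0" and "c > 0" "s > 0"
  shows "elliptic_cone l b c s \<in> fmeasurable lborel"
    and "measure lborel (elliptic_cone l b c s) =
     unit_cone_vol CARD('n) * s ^ CARD('n) * (\<Prod>i\<in>-{l}. sqrt (c / b i))"
proof -
  define m where "m i = (if i = l then s else s * sqrt (c / b i))" for i
  have U: "unit_cone l \<in> sets borel" using open_unit_cone by (rule borel_open)
  have "unit_cone l \<in> lmeasurable"
    using emeasure_unit_cone[OF assms(1), of l] U by (intro fmeasurableI) auto
  note st = measurable_stretch[OF this, of m] measure_stretch[OF this, of m]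
  have eq: "elliptic_cone l b c s = (\<lambda>x. \<chi> i. m i * x $ i) ` unit_cone l"
    unfolding m_def using assms by (intro elliptic_cone_eq_stretch) auto
  show "elliptic_cone l b c s \<in> fmeasurable lborel"
    using st(1) borel_open[OF open_elliptic_cone, of l b c s] by (simp add: eq[symmetric] fmeasurable_def)
  have m: "m i > 0" for i using assms by (auto simp: m_def)
  have "prod m UNIV = m l * prod m (-{l})"
    by (simp add: prod.remove Compl_eq_Diff_UNIV)
  also have "prod m (-{l}) = (\<Prod>i\<in>-{l}. s * sqrt (c / b i))"
    by (rule prod.cong) (auto simp: m_def)
  also have "m l * \<dots> = s ^ Suc (card (-{l})) * (\<Prod>i\<in>-{l}. sqrt (c / b i))"
    by (simp add: m_def prod.distrib)
  also have "Suc (card (-{l})) = CARD('n)"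
    using assms(1) by (simp add: Compl_eq_Diff_UNIV)
  finally have pm: "prod m UNIV = s ^ CARD('n) * (\<Prod>i\<in>-{l}. sqrt (c / b i))" .
  have "measure lborel (elliptic_cone l b c s) = measure lebesgue (elliptic_cone l b c s)"
    using borel_open[OF open_elliptic_cone] by (subst measure_completion) auto
  also have "\<dots> = \<bar>prod m UNIV\<bar> * measure lebesgue (unit_cone l)"
    using st(2) eq by simp
  also have "measure lebesgue (unit_cone l) = unit_cone_vol CARD('n)"
    using emeasure_unit_cone[OF assms(1), of l] U by (simp add: measure_def)
  also have "\<bar>prod m UNIV\<bar> = s ^ CARD('n) * (\<Prod>i\<in>-{l}. sqrt (c / b i))"
    using m by (subst abs_of_pos) (auto simp: pm[symmetric] intro: prod_pos)
  finally show "measure lborel (elliptic_cone l b c s) =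
     unit_cone_vol CARD('n) * s ^ CARD('n) * (\<Prod>i\<in>-{l}. sqrt (c / b i))"
    by simp
qed

section \<open>Radial projection into a long ellipsoid\<close>

text \<open>
The points \<open>y\<close> of the unit ball whose radial projection \<open>z\<close> to the sphere of radius \<open>r\<close> lies in
the ellipsoid \<open>\<Sum>i. (\<alpha> i * z $ i)\<^sup>2 < 1\<close>, see \<open>mem_needle_iff_norm\<close>. Written as a quadratic inequality,
it is visibly a truncated elliptic cone when one coefficient is negative and all others are positive.
\<close>

definition needle :: "('n::finite \<Rightarrow> real) \<Rightarrow> real \<Rightarrow> (real^'n) set" where
  "needle \<alpha> r = {y \<in> ball 0 1. (\<Sum>i\<in>UNIV. ((\<alpha> i * r)\<^sup>2 - 1) * (y $ i)\<^sup>2) < 0}"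

lemma open_needle: "open (needle \<alpha> r)"
proof -
  have "needle \<alpha> r = ball 0 1 \<inter> {y. (\<Sum>i\<in>UNIV. ((\<alpha> i * r)\<^sup>2 - 1) * (y $ i)\<^sup>2) < 0}"
    by (auto simp: needle_def)
  then show ?thesis
    by (simp add: open_Int open_Collect_less continuous_intros)
qed

lemma needle_fmeasurable: "needle \<alpha> r \<in> fmeasurable lborel"
proof (rule fmeasurableI2)
  show "ball (0::real^'a) 1 \<in> fmeasurable lborel" by (simp add: fmeasurable_def emeasure_ball)
qed (use borel_open[OF open_needle, of \<alpha> r] in \<open>auto simp: needle_def\<close>)

lemma norm_power2_vec: "(norm (y :: real^'n))\<^sup>2 = (\<Sum>i\<in>UNIV. (y $ i)\<^sup>2)"
  by (simp add: norm_vec_def L2_set_def sum_nonneg)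

lemma mem_needle_iff_norm:
  assumes "r \<ge> 0"
  shows "y \<in> needle \<alpha> r \<longleftrightarrow> norm y < 1 \<and> r * norm (\<chi> i. \<alpha> i * y $ i) < norm y"
proof -
  have "r * norm (\<chi> i. \<alpha> i * y $ i) < norm y \<longleftrightarrow> (r * norm (\<chi> i. \<alpha> i * y $ i))\<^sup>2 < (norm y)\<^sup>2"
    using assms by (meson norm_ge_zero mult_nonneg_nonneg not_le power2_le_imp_le power_mono)
  also have "(r * norm (\<chi> i. \<alpha> i * y $ i))\<^sup>2 = (\<Sum>i\<in>UNIV. (\<alpha> i * r)\<^sup>2 * (y $ i)\<^sup>2)"
    by (simp add: power_mult_distrib norm_power2_vec sum_distrib_left mult_ac)
  also have "\<dots> < (norm y)\<^sup>2 \<longleftrightarrow> (\<Sum>i\<in>UNIV. ((\<alpha> i * r)\<^sup>2 - 1) * (y $ i)\<^sup>2) < 0"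
    by (simp add: norm_power2_vec sum_subtractf left_diff_distrib)
  finally show ?thesis by (simp add: needle_def)
qed

text \<open>
The first summand comes from the comparison with a box at small radii, the second one from the
comparison with truncated cones.
\<close>

definition error_const :: "nat \<Rightarrow> real" where
  "error_const n = 2 * (2 ^ n + unit_cone_vol n) + unit_cone_vol n * n * 2 ^ n"

text \<open>
From here on \<open>\<alpha> l\<close> is the reciprocal of the longest semi-axis of the ellipsoid, and \<open>T\<close> is the radius \<open>r\<close>
measured in units of this semi-axis.
\<close>

context
  fixes \<alpha> :: "'n::finite \<Rightarrow> real" and l :: 'n and r T :: real
  assumes dim: "CARD('n) \<ge> 2"
    and pos: "\<And>i. \<alpha> i > 0" and prod_1: "(\<Prod>i\<in>UNIV. \<alpha> i) = 1"
    and r: "r > 0" and T_eq: "T = \<alpha> l * r"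
begin

lemma T_pos: "T > 0"
  using pos r by (simp add: T_eq)

lemma split_sum_l: "(\<Sum>i\<in>UNIV. h i) = h l + (\<Sum>i\<in>-{l}. h i :: real)"
  by (simp add: sum.remove Compl_eq_Diff_UNIV)

lemma card_Compl_l: "card (-{l}) = CARD('n) - 1"
  by (simp add: Compl_eq_Diff_UNIV)

lemma prod_other_axes:
  "(\<Prod>i\<in>-{l}. u / (\<alpha> i * r)) = \<alpha> l ^ CARD('n) * (u / T) ^ (CARD('n) - 1)"
proof -
  have "1 = \<alpha> l * (\<Prod>i\<in>-{l}. \<alpha> i)"
    using prod_1 by (simp add: prod.remove Compl_eq_Diff_UNIV)
  then have p: "(\<Prod>i\<in>-{l}. \<alpha> i) = 1 / \<alpha> l"
    using pos[of l] by (simp add: field_simps)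
  define k where "k = CARD('n) - 1"
  have "(\<Prod>i\<in>-{l}. u / (\<alpha> i * r)) = u ^ k * \<alpha> l / r ^ k"
    by (simp add: prod_dividef prod.distrib p card_Compl_l k_def)
  also have "\<dots> = \<alpha> l ^ Suc k * (u / T) ^ k"
    using pos[of l] r by (simp add: T_eq power_divide power_mult_distrib)
  also have "Suc k = CARD('n)" using dim by (simp add: k_def)
  finally show ?thesis by (simp add: k_def)
qed

text \<open>
Up to the constant \<open>unit_cone_vol\<close>, this is the volume of the double cone of height \<open>1\<close> whose coefficients
\<open>(\<alpha> i * r)\<^sup>2 - 1\<close>, for \<open>i \<noteq> l\<close>, are replaced by \<open>(\<alpha> i * r)\<^sup>2\<close>.
\<close>

abbreviation profile :: real where
  "profile \<equiv> \<alpha> l ^ CARD('n) * (sqrt (1 - T\<^sup>2) / T) ^ (CARD('n) - 1)"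

text \<open>
If all short semi-axes are at most \<open>r / A\<close>, the needle is an elliptic cone cut off by the unit
sphere. Cutting it off at height \<open>1\<close> instead enlarges it. Points of the cone satisfy
\<open>q * (norm y)\<^sup>2 \<le> (y $ l)\<^sup>2\<close>, because the cone is thin; hence cutting it off at height \<open>q\<close> brings it
into the unit ball. The two truncated cones have explicit volumes, and \<open>(\<alpha> i * r)\<^sup>2 - 1\<close> differs
from \<open>(\<alpha> i * r)\<^sup>2\<close> at most by the factor \<open>q\<close>.
\<close>

lemma needle_bounds:
  assumes "T < 1" "A > 1" and A: "\<And>i. i \<noteq> l \<Longrightarrow> \<alpha> i * r \<ge> A" and q: "q = 1 - 1 / A\<^sup>2"
  shows "measure lborel (needle \<alpha> r) \<le> unit_cone_vol CARD('n) * profile / q ^ CARD('n)"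
    and "q ^ CARD('n) * (unit_cone_vol CARD('n) * profile) \<le> measure lborel (needle \<alpha> r)"
proof -
  define b c where "b i = (\<alpha> i * r)\<^sup>2 - 1" and "c = 1 - T\<^sup>2" for i
  have A2: "A\<^sup>2 > 1" using assms(2) by (simp add: power2_eq_square) (meson less_1_mult)
  then have "1 / A\<^sup>2 < 1" by (subst divide_less_eq_1_pos) auto
  then have q01: "0 < q" "q < 1" using A2 by (auto simp: q)
  have c: "0 < c" "c \<le> 1" using assms(1) T_pos by (auto simp: c_def power_less_one_iff abs_square_less_1)
  have sq: "(\<alpha> i * r)\<^sup>2 \<ge> A\<^sup>2" if "i \<noteq> l" for i
    using A[OF that] assms(2) by (intro power_mono) auto
  have b: "b i > 0" "b i \<le> (\<alpha> i * r)\<^sup>2" "b i \<ge> q * (\<alpha> i * r)\<^sup>2" "b i \<ge> A\<^sup>2 - 1" if "i \<noteq> l" for i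
  proof -
    show "b i \<ge> q * (\<alpha> i * r)\<^sup>2"
      using sq[OF that] assms(2) by (simp add: b_def q left_diff_distrib)
  qed (use sq[OF that] A2 in \<open>auto simp: b_def\<close>)
  have T_sq: "(\<alpha> l * r)\<^sup>2 - 1 = - c" by (simp add: c_def T_eq)
  have mem: "y \<in> needle \<alpha> r \<longleftrightarrow> norm y < 1 \<and> (\<Sum>i\<in>-{l}. b i * (y $ i)\<^sup>2) < c * (y $ l)\<^sup>2" for y
    unfolding needle_def split_sum_l b_def[symmetric]
    unfolding b_def T_sq by auto
  have cone: "measure lborel (elliptic_cone l b c s) = unit_cone_vol CARD('n) * s ^ CARD('n) * (\<Prod>i\<in>-{l}. sqrt (c / b i))"
    "elliptic_cone l b c s \<in> fmeasurable lborel" if "s > 0" for s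
    using measure_elliptic_cone[of l b c s, OF dim b(1) c(1) that] by simp_all
  have root: "sqrt (c / b i) \<le> (sqrt c / (\<alpha> i * r)) / q" "sqrt c / (\<alpha> i * r) \<le> sqrt (c / b i)" if "i \<noteq> l" for i
  proof -
    have ar: "\<alpha> i * r > 0" using pos r by simp
    have "(q * (\<alpha> i * r))\<^sup>2 \<le> q * (\<alpha> i * r)\<^sup>2"
      unfolding power_mult_distrib using q01
      by (intro mult_right_mono) (simp_all add: power2_eq_square mult_left_le)
    also note b(3)[OF that]
    finally have "q * (\<alpha> i * r) \<le> sqrt (b i)" by (rule real_le_rsqrt)
    then have "sqrt c / sqrt (b i) \<le> sqrt c / (q * (\<alpha> i * r))"
      using q01 ar c b(1)[OF that] by (intro divide_left_mono) auto
    then show "sqrt (c / b i) \<le> (sqrt c / (\<alpha> i * r)) / q"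
      by (simp add: real_sqrt_divide mult_ac)
    have "sqrt (b i) \<le> \<alpha> i * r"
      using b(2)[OF that] ar by (intro real_le_lsqrt) auto
    then show "sqrt c / (\<alpha> i * r) \<le> sqrt (c / b i)"
      using ar c b(1)[OF that] by (simp add: real_sqrt_divide) (intro divide_left_mono, auto)
  qed
  have profile: "(\<Prod>i\<in>-{l}. sqrt c / (\<alpha> i * r)) = profile"
    by (simp only: prod_other_axes c_def)
  have kap: "unit_cone_vol CARD('n) \<ge> 0" by simp
  have profile_nonneg: "profile \<ge> 0"
    using pos[of l] T_pos c by (simp add: c_def less_imp_le)
  show "measure lborel (needle \<alpha> r) \<le> unit_cone_vol CARD('n) * profile / q ^ CARD('n)"
  proof -
    have "needle \<alpha> r \<subseteq> elliptic_cone l b c 1"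
      using component_le_norm_cart by (fastforce simp: mem elliptic_cone_def intro: order.strict_trans1)
    then have "measure lborel (needle \<alpha> r) \<le> measure lborel (elliptic_cone l b c 1)"
      using cone(2)[of 1] borel_open[OF open_needle] by (intro measure_mono_fmeasurable) auto
    also have "\<dots> = unit_cone_vol CARD('n) * (\<Prod>i\<in>-{l}. sqrt (c / b i))"
      using cone(1)[of 1] by simp
    also have "(\<Prod>i\<in>-{l}. sqrt (c / b i)) \<le> (\<Prod>i\<in>-{l}. (sqrt c / (\<alpha> i * r)) / q)"
      using root(1) c b(1) by (intro prod_mono) (auto simp: less_imp_le)
    also have "\<dots> = profile / q ^ (CARD('n) - 1)"
      unfolding profile[symmetric] prod_dividef by (simp add: card_Compl_l)
    also have "\<dots> \<le> profile / q ^ CARD('n)"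
      using q01 profile_nonneg by (intro divide_left_mono power_decreasing) auto
    finally show ?thesis by (simp add: mult_left_mono)
  qed
  show "q ^ CARD('n) * (unit_cone_vol CARD('n) * profile) \<le> measure lborel (needle \<alpha> r)"
  proof -
    have "elliptic_cone l b c q \<subseteq> needle \<alpha> r"
    proof
      fix y assume y: "y \<in> elliptic_cone l b c q"
      let ?S = "\<Sum>i\<in>-{l}. (y $ i)\<^sup>2"
      have "(A\<^sup>2 - 1) * ?S \<le> (\<Sum>i\<in>-{l}. b i * (y $ i)\<^sup>2)"
        unfolding sum_distrib_left using b(4) by (intro sum_mono mult_right_mono) auto
      also have "\<dots> < c * (y $ l)\<^sup>2" using y by (simp add: elliptic_cone_def)
      also have "\<dots> \<le> (y $ l)\<^sup>2" using c by (simp add: mult_left_le_one_le)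
      finally have S: "(A\<^sup>2 - 1) * ?S < (y $ l)\<^sup>2" .
      have "(A\<^sup>2 - 1) * (norm y)\<^sup>2 = (A\<^sup>2 - 1) * (y $ l)\<^sup>2 + (A\<^sup>2 - 1) * ?S"
        by (simp add: norm_power2_vec split_sum_l distrib_left)
      also have "\<dots> < A\<^sup>2 * (y $ l)\<^sup>2" using S by (simp add: left_diff_distrib)
      also have "(A\<^sup>2 - 1) * (norm y)\<^sup>2 = A\<^sup>2 * (q * (norm y)\<^sup>2)"
        using assms(2) by (simp add: q left_diff_distrib right_diff_distrib)
      finally have "q * (norm y)\<^sup>2 < (y $ l)\<^sup>2"
        by (rule mult_left_less_imp_less) simp
      also have "(y $ l)\<^sup>2 < q\<^sup>2"
        using y power_strict_mono[of "\<bar>y $ l\<bar>" q 2] by (simp add: elliptic_cone_def)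
      finally have "(norm y)\<^sup>2 < q" using q01 by (simp add: power2_eq_square)
      then have "(norm y)\<^sup>2 < 1" using q01 by simp
      then have "norm y < 1" by (simp add: power_less_one_iff abs_square_less_1)
      then show "y \<in> needle \<alpha> r" using y by (simp add: mem elliptic_cone_def)
    qed
    then have "measure lborel (elliptic_cone l b c q) \<le> measure lborel (needle \<alpha> r)"
      using borel_open[OF open_elliptic_cone] needle_fmeasurable
      by (intro measure_mono_fmeasurable) auto
    moreover have "measure lborel (elliptic_cone l b c q) = q ^ CARD('n) * (unit_cone_vol CARD('n) * (\<Prod>i\<in>-{l}. sqrt (c / b i)))"
      using cone(1)[OF q01(1)] by simp
    moreover have "profile \<le> (\<Prod>i\<in>-{l}. sqrt (c / b i))"
      unfolding profile[symmetric] using root(2) c pos r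
      by (intro prod_mono) (auto simp: less_imp_le)
    then have "q ^ CARD('n) * (unit_cone_vol CARD('n) * profile) \<le> q ^ CARD('n) * (unit_cone_vol CARD('n) * (\<Prod>i\<in>-{l}. sqrt (c / b i)))"
      using q01 kap by (intro mult_left_mono) auto
    ultimately show ?thesis by linarith
  qed
qed

text \<open>
For small \<open>r\<close> the needle is not thin, but it still lies in a box, which has the right order of
magnitude: \<open>\<bar>\<alpha> i * r * y $ i\<bar> < norm y < 1\<close> for every coordinate.
\<close>

lemma needle_crude_bound:
  "measure lborel (needle \<alpha> r) \<le> 2 ^ CARD('n) * (\<alpha> l ^ CARD('n) / T ^ (CARD('n) - 1))"
proof -
  define m where "m i = (if i = l then 1 else 1 / (\<alpha> i * r))" for i
  have m: "m i > 0" for i using pos r by (simp add: m_def)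
  have sub: "needle \<alpha> r \<subseteq> cbox (\<chi> i. - m i) (\<chi> i. m i)"
  proof
    fix y assume y: "y \<in> needle \<alpha> r"
    have "\<bar>y $ i\<bar> \<le> m i" for i
    proof (cases "i = l")
      case True
      then show ?thesis using y component_le_norm_cart[of y l] by (simp add: m_def needle_def)
    next
      case False
      have ar: "\<alpha> i * r > 0" using pos r by simp
      have "(\<alpha> i * r * y $ i)\<^sup>2 \<le> (\<Sum>i\<in>UNIV. (\<alpha> i * r * y $ i)\<^sup>2)"
        by (rule member_le_sum) auto
      also have "\<dots> < (norm y)\<^sup>2"
        using y by (simp add: needle_def norm_power2_vec left_diff_distrib sum_subtractf power_mult_distrib)
      also have "\<dots> \<le> 1\<^sup>2"
        using y by (intro power_mono) (auto simp: needle_def)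
      finally have "\<bar>\<alpha> i * r * y $ i\<bar> < 1" by (simp add: abs_square_less_1)
      then show ?thesis
        using ar False pos[of i] r by (simp add: m_def abs_mult field_simps)
    qed
    then show "y \<in> cbox (\<chi> i. - m i) (\<chi> i. m i)"
      by (simp add: mem_box_cart abs_le_iff) (metis minus_le_iff)
  qed
  then have "measure lborel (needle \<alpha> r) \<le> measure lborel (cbox (\<chi> i. - m i) (\<chi> i. m i))"
    using borel_open[OF open_needle, of \<alpha> r] 
    by (intro measure_mono_fmeasurable) (auto simp: fmeasurable_def emeasure_lborel_cbox_eq)
  also have "\<dots> = (\<Prod>i\<in>UNIV. 2 * m i)"
    using m by (subst content_cbox_cart) (auto simp: interval_ne_empty_cart less_imp_le intro!: exI[of _ 0])
  also have "\<dots> = 2 ^ CARD('n) * (m l * (\<Prod>i\<in>-{l}. m i))"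
    by (simp add: prod.distrib prod.remove Compl_eq_Diff_UNIV)
  also have "(\<Prod>i\<in>-{l}. m i) = (\<Prod>i\<in>-{l}. 1 / (\<alpha> i * r))"
    by (rule prod.cong) (auto simp: m_def)
  also have "\<dots> = \<alpha> l ^ CARD('n) / T ^ (CARD('n) - 1)"
    by (simp add: prod_other_axes power_divide)
  finally show ?thesis by (simp add: m_def)
qed

lemma needle_empty:
  assumes "T \<ge> 1" and "\<And>i. \<alpha> i \<ge> \<alpha> l"
  shows "needle \<alpha> r = {}"
proof -
  have "(\<alpha> i * r)\<^sup>2 \<ge> 1" for i
  proof -
    have "1 \<le> \<alpha> i * r"
      using assms(1) mult_right_mono[OF assms(2)[of i], of r] r by (auto simp: T_eq intro: order_trans)
    then show ?thesis by (simp add: one_le_power)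
  qed
  then have "(\<Sum>i\<in>UNIV. ((\<alpha> i * r)\<^sup>2 - 1) * (y $ i)\<^sup>2) \<ge> 0" for y :: "real^'n"
    by (intro sum_nonneg mult_nonneg_nonneg) auto
  then show ?thesis by (auto simp: needle_def not_less[symmetric])
qed

text \<open>
With \<open>\<rho> = \<delta> / T\<close>, the relative error is of order \<open>\<rho>\<^sup>2\<close> when \<open>\<rho> \<le> 1/2\<close>, by the two-sided bound, and
bounded otherwise, by the box. Both are dominated by \<open>\<rho> powr (2/3)\<close>; an exponent below \<open>1\<close> is
what keeps the integral of the error over small \<open>T\<close> finite.
\<close>

lemma needle_approx:
  assumes "0 < \<delta>" "\<delta> \<le> 1" and gap: "\<And>i. i \<noteq> l \<Longrightarrow> \<alpha> l \<le> \<delta> * \<alpha> i"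
  shows "\<bar>measure lborel (needle \<alpha> r) - (if T < 1 then unit_cone_vol CARD('n) * profile else 0)\<bar>
     \<le> (if T < 1 then error_const CARD('n) * (\<alpha> l ^ CARD('n) / T ^ (CARD('n) - 1)) * (\<delta> / T) powr (2/3) else 0)"
proof (cases "T < 1")
  case False
  have "\<alpha> i \<ge> \<alpha> l" for i
  proof (cases "i = l")
    case False
    have "\<delta> * \<alpha> i \<le> 1 * \<alpha> i" using assms(2) pos[of i] by (intro mult_right_mono) auto
    with gap[OF False] show ?thesis by simp
  qed simp
  with False show ?thesis using needle_empty by simp
next
  case True
  define K where "K = error_const CARD('n)"
  define E where "E = \<alpha> l ^ CARD('n) / T ^ (CARD('n) - 1)"
  define \<rho> where "\<rho> = \<delta> / T"
  define V where "V = measure lborel (needle \<alpha> r)"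
  have E: "E > 0" using pos T_pos by (simp add: E_def)
  have \<rho>: "\<rho> > 0" using assms(1) T_pos by (simp add: \<rho>_def)
  have kap: "unit_cone_vol CARD('n) \<ge> 0" by simp
  have T1: "T\<^sup>2 < 1" using True T_pos by (simp add: abs_square_less_1)
  have P0: "profile \<ge> 0" using pos T_pos T1 by (simp add: less_imp_le)
  have "sqrt (1 - T\<^sup>2) ^ (CARD('n) - 1) \<le> 1"
    using T1 by (intro power_le_one) auto
  then have PE: "profile \<le> E"
    using pos[of l] T_pos by (simp add: E_def power_divide divide_right_mono mult_left_le)
  have kapPE: "unit_cone_vol CARD('n) * profile \<le> unit_cone_vol CARD('n) * E" using PE kap by (rule mult_left_mono)
  have kapP0: "0 \<le> unit_cone_vol CARD('n) * profile" using kap P0 by (rule mult_nonneg_nonneg)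
  have "\<bar>V - unit_cone_vol CARD('n) * profile\<bar> \<le> K * E * \<rho> powr (2/3)"
  proof (cases "\<rho> \<le> 1/2")
    case True
    define q where "q = 1 - \<rho>\<^sup>2"
    have "\<rho>\<^sup>2 \<le> (1/2)\<^sup>2" using True \<rho> by (intro power_mono) auto
    then have q: "1/2 \<le> q" "q \<le> 1" by (auto simp: q_def power2_eq_square)
    have A: "\<alpha> i * r \<ge> 1 / \<rho>" if "i \<noteq> l" for i
    proof -
      have "T \<le> \<delta> * (\<alpha> i * r)"
        using mult_right_mono[OF gap[OF that], of r] r by (simp add: T_eq mult.assoc)
      then show ?thesis using assms(1) T_pos by (simp add: \<rho>_def field_simps)
    qed
    have \<rho>1: "1 / \<rho> > 1" using True \<rho> by (simp add: field_simps)
    have q_eq: "q = 1 - 1 / (1 / \<rho>)\<^sup>2" by (simp add: q_def power_divide)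
    have nb: "V \<le> unit_cone_vol CARD('n) * profile / q ^ CARD('n)"
      "q ^ CARD('n) * (unit_cone_vol CARD('n) * profile) \<le> V"
      unfolding V_def using needle_bounds[OF \<open>T < 1\<close> \<rho>1 A q_eq] by simp_all
    have ring: "x * ((1 / z) * (1 - z)) = x / z - x" if "z \<noteq> 0" for x z :: real
      using that by (simp add: field_simps)
    have ring': "x * (1 - z) = x - z * x" for x z :: real
      by (simp add: algebra_simps)
    have qN: "1 - q ^ CARD('n) \<le> CARD('n) * \<rho>\<^sup>2"
      using Bernoulli_inequality[of "- \<rho>\<^sup>2" "CARD('n)"] q by (simp add: q_def)
    have qN1: "q ^ CARD('n) \<le> 1" using q by (intro power_le_one) auto
    have qN2: "1 / q ^ CARD('n) \<le> 2 ^ CARD('n)"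
      using power_mono[of "1 / q" 2 "CARD('n)"] q by (simp add: power_one_over field_simps)
    have "V - unit_cone_vol CARD('n) * profile \<le> unit_cone_vol CARD('n) * profile * ((1 / q ^ CARD('n)) * (1 - q ^ CARD('n)))"
      using nb(1) q by (subst ring) auto
    also have "\<dots> \<le> unit_cone_vol CARD('n) * E * (2 ^ CARD('n) * (CARD('n) * \<rho>\<^sup>2))"
      using qN qN1 qN2 PE P0 q E kap by (intro mult_mono) auto
    finally have 1: "V - unit_cone_vol CARD('n) * profile \<le> unit_cone_vol CARD('n) * CARD('n) * 2 ^ CARD('n) * E * \<rho>\<^sup>2" by (simp add: mult_ac)
    have "unit_cone_vol CARD('n) * profile - V \<le> unit_cone_vol CARD('n) * profile * (1 - q ^ CARD('n))"
      using nb(2) by (subst ring') linarith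
    also have "\<dots> \<le> unit_cone_vol CARD('n) * E * (2 ^ CARD('n) * (CARD('n) * \<rho>\<^sup>2))"
    proof (intro mult_mono)
      have "1 * (CARD('n) * \<rho>\<^sup>2) \<le> 2 ^ CARD('n) * (CARD('n) * \<rho>\<^sup>2)"
        by (intro mult_right_mono) auto
      with qN show "1 - q ^ CARD('n) \<le> 2 ^ CARD('n) * (CARD('n) * \<rho>\<^sup>2)" by linarith
    qed (use PE P0 qN1 E kap in auto)
    finally have 2: "unit_cone_vol CARD('n) * profile - V \<le> unit_cone_vol CARD('n) * CARD('n) * 2 ^ CARD('n) * E * \<rho>\<^sup>2" by (simp add: mult_ac)
    have "\<bar>V - unit_cone_vol CARD('n) * profile\<bar> \<le> unit_cone_vol CARD('n) * CARD('n) * 2 ^ CARD('n) * E * \<rho>\<^sup>2"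
      using 1 2 by linarith
    also have "\<dots> \<le> K * E * \<rho> powr (2/3)"
    proof (intro mult_mono)
      have "\<rho>\<^sup>2 = \<rho> powr 2" using \<rho> by (simp add: powr_numeral)
      also have "\<dots> \<le> \<rho> powr (2/3)" using \<rho> True by (intro powr_mono') auto
      finally show "\<rho>\<^sup>2 \<le> \<rho> powr (2/3)" .
    qed (use E kap in \<open>auto simp: K_def error_const_def\<close>)
    finally show ?thesis .
  next
    case False
    have "V \<le> 2 ^ CARD('n) * E"
      unfolding V_def E_def by (rule needle_crude_bound)
    then have "\<bar>V - unit_cone_vol CARD('n) * profile\<bar> \<le> (2 ^ CARD('n) + unit_cone_vol CARD('n)) * E"
    proof -
      assume "V \<le> 2 ^ CARD('n) * E"
      moreover have "V \<ge> 0" by (simp add: V_def)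
      moreover have "(2 ^ CARD('n) + unit_cone_vol CARD('n)) * E = 2 ^ CARD('n) * E + unit_cone_vol CARD('n) * E" by (rule distrib_right)
      moreover have "2 ^ CARD('n) * E \<ge> 0" using E by simp
      ultimately show ?thesis using kapPE kapP0 by linarith
    qed
    also have "\<dots> = (2 * (2 ^ CARD('n) + unit_cone_vol CARD('n))) * E * (1/2)" by simp
    also have "\<dots> \<le> K * E * \<rho> powr (2/3)"
    proof (intro mult_mono)
      have "(1/2 :: real) = (1/2) powr 1" by simp
      also have "\<dots> \<le> (1/2) powr (2/3)" by (rule powr_mono') auto
      also have "\<dots> \<le> \<rho> powr (2/3)" using False by (intro powr_mono2) auto
      finally show "1/2 \<le> \<rho> powr (2/3)" .
    qed (use E kap in \<open>auto simp: K_def error_const_def\<close>)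
    finally show ?thesis .
  qed
  with True show ?thesis by (simp add: K_def V_def E_def \<rho>_def)
qed

end

section \<open>Radial integrals against a measure of bounded ball growth\<close>

text \<open>
The function \<open>(sqrt (1 - \<tau>\<^sup>2) / \<tau>) ^ d / d\<close> is minus an antiderivative of the integrand. For \<open>d = 1\<close> the
integrand is unbounded at \<open>1\<close>, but the antiderivative remains continuous there, which suffices for
the fundamental theorem.
\<close>

lemma nn_integral_profile_density:
  assumes T: "0 < T" and d: "d \<ge> (1::nat)"
  shows "(\<integral>\<^sup>+\<tau>. ennreal ((1 - \<tau>\<^sup>2) powr ((real d - 2) / 2) / \<tau> ^ Suc d) * indicator {T..1} \<tau> \<partial>lborel)
    = ennreal (if T < 1 then (sqrt (1 - T\<^sup>2) / T) ^ d / real d else 0)"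
proof (cases "T < 1")
  case True
  let ?w = "\<lambda>\<tau>::real. (1 - \<tau>\<^sup>2) powr ((real d - 2) / 2) / \<tau> ^ Suc d"
  let ?F = "\<lambda>\<tau>::real. - ((sqrt (1 - \<tau>\<^sup>2) / \<tau>) ^ d / real d)"
  have "(?w has_integral (?F 1 - ?F T)) {T..1}"
  proof (rule fundamental_theorem_of_calculus_interior)
    show "continuous_on {T..1} ?F"
      using T d by (intro continuous_intros) auto
    fix \<tau> assume "\<tau> \<in> {T<..<1}"
    then have \<tau>: "0 < \<tau>" "\<tau> < 1" "\<tau>\<^sup>2 < 1" using T by (auto simp: abs_square_less_1)
    define s where "s = sqrt (1 - \<tau>\<^sup>2)"
    have s: "s > 0" "s\<^sup>2 = 1 - \<tau>\<^sup>2" using \<tau> by (auto simp: s_def)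
    obtain e where e: "d = Suc e" using d by (cases d) auto
    have "((\<lambda>\<tau>. sqrt (1 - \<tau>\<^sup>2)) has_real_derivative - (\<tau> / s)) (at \<tau>)"
      using \<tau> unfolding s_def by (auto intro!: derivative_eq_intros simp: field_simps)
    from DERIV_divide[OF this DERIV_ident]
    have "((\<lambda>\<tau>. sqrt (1 - \<tau>\<^sup>2) / \<tau>) has_real_derivative (- (\<tau> / s) * \<tau> - s) / \<tau>\<^sup>2) (at \<tau>)"
      using \<tau> by (simp add: s_def power2_eq_square)
    also have "(- (\<tau> / s) * \<tau> - s) / \<tau>\<^sup>2 = - (\<tau>\<^sup>2 + s\<^sup>2) / (s * \<tau>\<^sup>2)"
      using \<tau> s(1) by (simp add: field_simps power2_eq_square)
    finally have "((\<lambda>\<tau>. sqrt (1 - \<tau>\<^sup>2) / \<tau>) has_real_derivative - 1 / (s * \<tau>\<^sup>2)) (at \<tau>)"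
      by (simp add: s(2))
    from DERIV_minus[OF DERIV_cdivide[OF DERIV_power[OF this, of d], of "real d"]]
    have "(?F has_real_derivative (s / \<tau>) ^ e * (1 / (s * \<tau>\<^sup>2))) (at \<tau>)"
      by (simp add: e s_def mult.commute)
    also have "(s / \<tau>) ^ e * (1 / (s * \<tau>\<^sup>2)) = s ^ e / s / \<tau> ^ Suc d"
      using \<tau> s(1) by (simp add: e power_divide power2_eq_square field_simps)
    also have "s ^ e / s = (1 - \<tau>\<^sup>2) powr ((real d - 2) / 2)"
    proof -
      have "(1 - \<tau>\<^sup>2) powr ((real d - 2) / 2) = s powr (real d - 2)"
        using s \<tau> by (simp add: s_def powr_half_sqrt[symmetric] powr_powr)
      also have "\<dots> = s powr (real e - 1)" by (simp add: e)
      also have "\<dots> = s ^ e / s" using s(1) by (simp add: powr_diff powr_realpow)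
      finally show ?thesis ..
    qed
    finally show "(?F has_vector_derivative ?w \<tau>) (at \<tau>)"
      by (simp add: has_real_derivative_iff_has_vector_derivative)
  qed (use True in auto)
  moreover have "(0::real) ^ d = 0" using d by (simp add: zero_power)
  ultimately have "(?w has_integral ((sqrt (1 - T\<^sup>2) / T) ^ d / real d)) {T..1}"
    by simp
  then show ?thesis
    using T True by (subst nn_integral_has_integral_lebesgue') auto
next
  case False
  have "AE \<tau> in lborel. \<tau> \<notin> {1::real}" by (intro AE_not_in) auto
  then have "AE \<tau> in lborel. ennreal ((1 - \<tau>\<^sup>2) powr ((real d - 2) / 2) / \<tau> ^ Suc d) * indicator {T..1} \<tau> = 0"
    by eventually_elim (use False in \<open>auto simp: indicator_def\<close>)
  from nn_integral_cong_AE[OF this] show ?thesis using False by simp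
qed

text \<open>
The factor \<open>2 powr (1/3) * 3\<close> is the integral of \<open>\<tau> powr (- (2/3))\<close> over \<open>{0..2}\<close>.
\<close>

definition singular_power_const :: "nat \<Rightarrow> real" where
  "singular_power_const n = 2 ^ Suc n * (2 powr (1/3) * 3)"

locale ball_growth =
  fixes \<nu> :: "(real^'n::finite) measure"
  assumes sets_eq [measurable_cong]: "sets \<nu> = sets borel" and M_finite: "M_sup \<nu> < \<infinity>"
begin

definition M :: real where "M = enn2real (M_sup \<nu>)"

lemma M_nonneg: "M \<ge> 0" by (simp add: M_def)

lemma N_mass_le:
  assumes "R > 0"
  shows "N_mass \<nu> R \<le> ennreal (M * R ^ CARD('n))"
proof -
  let ?c = "ennreal (R ^ CARD('n))"
  have c: "?c \<noteq> 0" "?c \<noteq> \<infinity>" using assms by auto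
  have "N_mass \<nu> R / ?c \<le> M_sup \<nu>"
    unfolding M_sup_def using assms by (intro SUP_upper) auto
  then have "N_mass \<nu> R / ?c * ?c \<le> M_sup \<nu> * ?c"
    by (rule mult_right_mono) simp
  also have "N_mass \<nu> R / ?c * ?c = N_mass \<nu> R"
    using c by (simp add: ennreal_divide_times ennreal_mult_divide_eq mult_divide_eq_ennreal)
  also have "M_sup \<nu> = ennreal M"
    using M_finite by (simp add: M_def)
  finally show ?thesis using assms M_nonneg by (simp add: ennreal_mult)
qed

lemma N_mass_finite: "N_mass \<nu> R < \<infinity>"
proof (cases "R > 0")
  case True
  then show ?thesis using N_mass_le[OF True] by (metis ennreal_less_top infinity_ennreal_def le_less_trans)
next
  case False
  then have "ball (0::real^'n) R = {}" by (simp add: ball_empty)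
  then have "N_mass \<nu> R = 0" unfolding N_mass_def by (simp only: emeasure_empty)
  then show ?thesis by simp
qed

sublocale sigma_finite_measure \<nu>
proof
  have "space \<nu> = UNIV" using sets_eq_imp_space_eq[OF sets_eq] by simp
  moreover have "x \<in> (\<Union>n. ball 0 (real n))" for x :: "real^'n"
    using reals_Archimedean2[of "norm x"] by auto
  then have "(\<Union>n. ball (0::real^'n) (real n)) = UNIV" by blast
  ultimately show "\<exists>A. countable A \<and> A \<subseteq> sets \<nu> \<and> \<Union> A = space \<nu> \<and> (\<forall>a\<in>A. emeasure \<nu> a \<noteq> \<infinity>)"
    using N_mass_finite
    by (intro exI[of _ "range (\<lambda>n. ball 0 (real n))"]) (auto simp: sets_eq N_mass_def less_top)
qed

text \<open>
The origin carries no mass because the balls around it have mass of order \<open>R ^ CARD('n)\<close>. Its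
contribution to the profile and to the error bound, which are singular there, is thereby irrelevant.
\<close>

lemma AE_nonzero: "AE x in \<nu>. x \<noteq> 0"
proof -
  have "((\<lambda>R. ennreal (M * R ^ CARD('n))) \<longlongrightarrow> ennreal (M * 0 ^ CARD('n))) (at_right 0)"
    by (intro tendsto_intros)
  moreover have "\<forall>\<^sub>F R in at_right 0. emeasure \<nu> {0} \<le> ennreal (M * R ^ CARD('n))"
  proof -
    have "\<forall>\<^sub>F R in at_right 0. R \<in> {0<..<1::real}" by (rule eventually_at_right_real) simp
    then show ?thesis
    proof eventually_elim
      case (elim R)
      have "emeasure \<nu> {0} \<le> N_mass \<nu> R"
        unfolding N_mass_def using elim by (intro emeasure_mono) (auto simp: sets_eq)
      also have "\<dots> \<le> ennreal (M * R ^ CARD('n))" using elim by (intro N_mass_le) auto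
      finally show ?case .
    qed
  qed
  ultimately have "emeasure \<nu> {0} \<le> ennreal (M * 0 ^ CARD('n))"
    by (rule tendsto_lowerbound) simp
  then have "emeasure \<nu> {0} = 0" by (simp add: zero_power)
  then have "{0} \<in> null_sets \<nu>" by (auto simp: null_sets_def sets_eq)
  from AE_not_in[OF this] show ?thesis by simp
qed

lemma N_mass_eq_nn_integral:
  assumes "a > 0"
  shows "N_mass \<nu> (\<tau> / a) = (\<integral>\<^sup>+x. indicator {p. a * norm (snd p) < fst p} (\<tau>, x) \<partial>\<nu>)"
proof -
  have "(\<integral>\<^sup>+x. indicator {p. a * norm (snd p) < fst p} (\<tau>, x) \<partial>\<nu>) = (\<integral>\<^sup>+x. indicator (ball 0 (\<tau> / a)) x \<partial>\<nu>)"
    using assms by (intro nn_integral_cong) (auto simp: indicator_def field_simps)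
  also have "\<dots> = N_mass \<nu> (\<tau> / a)"
    by (subst nn_integral_indicator) (auto simp: N_mass_def sets_eq)
  finally show ?thesis ..
qed

lemma N_mass_measurable [measurable]:
  assumes "a > 0"
  shows "(\<lambda>\<tau>. N_mass \<nu> (\<tau> / a)) \<in> borel_measurable borel"
  unfolding N_mass_eq_nn_integral[OF assms]
  by (rule borel_measurable_nn_integral) (auto simp: split_beta')

text \<open>
A radial function written as an integral over its superlevel balls sees the measure only
through the masses of balls.
\<close>

lemma layer_cake:
  assumes a: "a > 0" and [measurable]: "\<phi> \<in> borel_measurable borel"
  shows "(\<integral>\<^sup>+x. (\<integral>\<^sup>+\<tau>. (if a * norm x < \<tau> then \<phi> \<tau> else 0) \<partial>lborel) \<partial>\<nu>)
    = (\<integral>\<^sup>+\<tau>. N_mass \<nu> (\<tau> / a) * \<phi> \<tau> \<partial>lborel)"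
proof -
  interpret pair_sigma_finite "lborel :: real measure" \<nu> ..
  let ?i = "indicator {p. a * norm (snd p) < fst p} :: real \<times> (real^'n) \<Rightarrow> ennreal"
  have i [measurable]: "?i \<in> borel_measurable (lborel \<Otimes>\<^sub>M \<nu>)" by measurable
  have "(\<integral>\<^sup>+x. (\<integral>\<^sup>+\<tau>. (if a * norm x < \<tau> then \<phi> \<tau> else 0) \<partial>lborel) \<partial>\<nu>)
     = (\<integral>\<^sup>+x. (\<integral>\<^sup>+\<tau>. ?i (\<tau>, x) * \<phi> \<tau> \<partial>lborel) \<partial>\<nu>)"
    by (intro nn_integral_cong) (auto simp: indicator_def)
  also have "\<dots> = (\<integral>\<^sup>+\<tau>. (\<integral>\<^sup>+x. ?i (\<tau>, x) * \<phi> \<tau> \<partial>\<nu>) \<partial>lborel)"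
    by (rule Fubini'[where f="\<lambda>\<tau> x. ?i (\<tau>, x) * \<phi> \<tau>"]) measurable
  also have "\<dots> = (\<integral>\<^sup>+\<tau>. N_mass \<nu> (\<tau> / a) * \<phi> \<tau> \<partial>lborel)"
    unfolding N_mass_eq_nn_integral[OF a]
    by (intro nn_integral_cong nn_integral_multc) measurable
  finally show ?thesis .
qed

text \<open>
With \<open>T = a * norm x < 1\<close>, the integrand is at most a multiple of the integral of
\<open>\<tau> powr (- (2/3) - CARD('n))\<close> over \<open>{T<..2 * T}\<close>, whose length is \<open>T\<close>. The layer cake formula turns
this into an integral of ball masses, and the growth condition leaves the integrable
\<open>\<tau> powr (- (2/3))\<close>. The upper limit \<open>2\<close> of \<open>\<psi>\<close> leaves room for \<open>{T<..2 * T}\<close>, so that no boundary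
term at \<open>T = 1\<close> arises.
\<close>

lemma nn_integral_singular_power_le:
  assumes a: "a > 0"
  shows "(\<integral>\<^sup>+x. ennreal (if a * norm x < 1 then a ^ CARD('n) * (a * norm x) powr (1/3 - CARD('n)) else 0) \<partial>\<nu>)
     \<le> ennreal (singular_power_const CARD('n) * M)"
proof -
  let ?N = "CARD('n)"
  define \<psi> where "\<psi> \<tau> = ennreal (\<tau> powr (- (2/3) - ?N)) * indicator {0..2} \<tau>" for \<tau> :: real
  have [measurable]: "\<psi> \<in> borel_measurable borel" unfolding \<psi>_def by measurable
  let ?c = "ennreal (2 ^ Suc ?N * a ^ ?N)"
  have "(\<integral>\<^sup>+x. ennreal (if a * norm x < 1 then a ^ ?N * (a * norm x) powr (1/3 - ?N) else 0) \<partial>\<nu>)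
     \<le> (\<integral>\<^sup>+x. ?c * (\<integral>\<^sup>+\<tau>. (if a * norm x < \<tau> then \<psi> \<tau> else 0) \<partial>lborel) \<partial>\<nu>)"
  proof (rule nn_integral_mono_AE)
    from AE_nonzero show "AE x in \<nu>. ennreal (if a * norm x < 1 then a ^ ?N * (a * norm x) powr (1/3 - ?N) else 0)
      \<le> ?c * (\<integral>\<^sup>+\<tau>. (if a * norm x < \<tau> then \<psi> \<tau> else 0) \<partial>lborel)"
    proof eventually_elim
      case (elim x)
      define T where "T = a * norm x"
      have T: "T > 0" using elim a by (simp add: T_def)
      show ?case
      proof (cases "T < 1")
        case True
        let ?v = "(2 * T) powr (- (2/3) - ?N)"
        have "T powr (1/3 - ?N) = T powr (1 + (- (2/3) - ?N))" by simp
        also have "\<dots> = T * T powr (- (2/3) - ?N)" using T by (subst powr_add) simp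
        also have "T powr (- (2/3) - ?N) = 2 powr (2/3 + ?N) * ?v"
          using T by (simp add: powr_mult mult.assoc[symmetric] powr_add[symmetric])
        also have "2 powr (2/3 + ?N) \<le> 2 powr (real (Suc ?N))" by (intro powr_mono) auto
        also have "\<dots> = 2 ^ Suc ?N" by (rule powr_realpow) simp
        finally have 1: "T powr (1/3 - ?N) \<le> 2 ^ Suc ?N * (?v * T)"
          using T by (simp add: mult_ac mult_left_mono)
        have "ennreal (?v * T) = ennreal ?v * emeasure lborel {T<..2 * T}"
          using T by (simp add: ennreal_mult)
        also have "\<dots> = (\<integral>\<^sup>+\<tau>. ennreal ?v * indicator {T<..2 * T} \<tau> \<partial>lborel)"
          by (subst nn_integral_cmult_indicator) auto
        also have "\<dots> \<le> (\<integral>\<^sup>+\<tau>. (if T < \<tau> then \<psi> \<tau> else 0) \<partial>lborel)"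
          using T True
          by (intro nn_integral_mono) (auto simp: \<psi>_def indicator_def intro!: ennreal_leI powr_mono2')
        finally have 2: "ennreal (?v * T) \<le> (\<integral>\<^sup>+\<tau>. (if T < \<tau> then \<psi> \<tau> else 0) \<partial>lborel)" .
        have "ennreal (a ^ ?N * T powr (1/3 - ?N)) \<le> ennreal (a ^ ?N * (2 ^ Suc ?N * (?v * T)))"
          using 1 a by (intro ennreal_leI mult_left_mono) auto
        also have "\<dots> = ?c * ennreal (?v * T)"
          using a T by (subst ennreal_mult[symmetric]) (auto simp: mult_ac)
        also have "\<dots> \<le> ?c * (\<integral>\<^sup>+\<tau>. (if T < \<tau> then \<psi> \<tau> else 0) \<partial>lborel)"
          using 2 by (rule mult_left_mono) simp
        finally show ?thesis using True by (simp add: T_def)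
      qed (simp add: T_def)
    qed
  qed
  also have "\<dots> = ?c * (\<integral>\<^sup>+x. (\<integral>\<^sup>+\<tau>. (if a * norm x < \<tau> then \<psi> \<tau> else 0) \<partial>lborel) \<partial>\<nu>)"
    by (rule nn_integral_cmult) measurable
  also have "\<dots> = ?c * (\<integral>\<^sup>+\<tau>. N_mass \<nu> (\<tau> / a) * \<psi> \<tau> \<partial>lborel)"
    using a by (subst layer_cake) auto
  also have "\<dots> \<le> ?c * (\<integral>\<^sup>+\<tau>. ennreal (M / a ^ ?N) * (ennreal (\<tau> powr (- (2/3))) * indicator {0..2} \<tau>) \<partial>lborel)"
  proof (intro mult_left_mono nn_integral_mono)
    fix \<tau> :: real
    show "N_mass \<nu> (\<tau> / a) * \<psi> \<tau> \<le> ennreal (M / a ^ ?N) * (ennreal (\<tau> powr (- (2/3))) * indicator {0..2} \<tau>)"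
    proof (cases "0 < \<tau> \<and> \<tau> \<le> 2")
      case True
      have "N_mass \<nu> (\<tau> / a) * \<psi> \<tau> \<le> ennreal (M * (\<tau> / a) ^ ?N) * \<psi> \<tau>"
        using True a by (intro mult_right_mono N_mass_le) auto
      also have "\<dots> = ennreal (M * (\<tau> / a) ^ ?N * \<tau> powr (- (2/3) - ?N))"
        using True a M_nonneg by (simp add: \<psi>_def ennreal_mult[symmetric])
      also have "M * (\<tau> / a) ^ ?N * \<tau> powr (- (2/3) - ?N) = M / a ^ ?N * \<tau> powr (- (2/3))"
        using True by (simp add: powr_diff powr_realpow power_divide)
      also have "ennreal \<dots> = ennreal (M / a ^ ?N) * (ennreal (\<tau> powr (- (2/3))) * indicator {0..2} \<tau>)"
        using True a M_nonneg by (simp add: ennreal_mult[symmetric])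
      finally show ?thesis .
    qed (auto simp: \<psi>_def indicator_def)
  qed auto
  also have "\<dots> = ?c * (ennreal (M / a ^ ?N) * (\<integral>\<^sup>+\<tau>. ennreal (\<tau> powr (- (2/3))) * indicator {0..2} \<tau> \<partial>lborel))"
    by (subst nn_integral_cmult) auto
  also have "(\<integral>\<^sup>+\<tau>. ennreal (\<tau> powr (- (2/3))) * indicator {0..2::real} \<tau> \<partial>lborel) = ennreal (2 powr (1/3) * 3)"
    using has_integral_powr_from_0[of "- (2/3)" 2] by (subst nn_integral_has_integral_lebesgue') auto
  also have "?c * (ennreal (M / a ^ ?N) * ennreal (2 powr (1/3) * 3)) = ennreal (singular_power_const CARD('n) * M)"
    using a M_nonneg by (simp add: ennreal_mult[symmetric] singular_power_const_def mult_ac)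
  finally show ?thesis .
qed

text \<open>
This is where the weight \<open>(1 - \<tau>\<^sup>2) powr ((N - 3) / 2)\<close> of the main term comes from: it is, up to a power
of \<open>\<tau>\<close>, minus the derivative of the profile, and the layer cake formula integrates by parts.
\<close>

lemma nn_integral_profile:
  assumes a: "a > 0" and N: "CARD('n) \<ge> 2"
  shows "(\<integral>\<^sup>+x. ennreal (if a * norm x < 1 then a ^ CARD('n) * (sqrt (1 - (a * norm x)\<^sup>2) / (a * norm x)) ^ (CARD('n) - 1) else 0) \<partial>\<nu>)
    = ennreal (real (CARD('n) - 1)) * (\<integral>\<^sup>+\<tau>. ennreal (indicator {0..1} \<tau> * (enn2real (N_mass \<nu> (\<tau> / a)) / (\<tau> / a) ^ CARD('n)
              * (1 - \<tau>\<^sup>2) powr ((real CARD('n) - 3) / 2))) \<partial>lborel)"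
proof -
  let ?N = "CARD('n)" 
  define d where "d = ?N - 1"
  have d: "d \<ge> 1" "Suc d = ?N" "real ?N - 3 = real d - 2" using N by (auto simp: d_def)
  let ?u = "\<lambda>\<tau>::real. (1 - \<tau>\<^sup>2) powr ((real d - 2) / 2) / \<tau> ^ Suc d"
  define \<phi> where "\<phi> \<tau> = ennreal (a ^ ?N * ?u \<tau>) * indicator {0..1} \<tau>" for \<tau> :: real
  have [measurable]: "\<phi> \<in> borel_measurable borel" unfolding \<phi>_def by measurable
  have "(\<integral>\<^sup>+x. ennreal (if a * norm x < 1 then a ^ ?N * (sqrt (1 - (a * norm x)\<^sup>2) / (a * norm x)) ^ d else 0) \<partial>\<nu>)
    = (\<integral>\<^sup>+x. ennreal d * (\<integral>\<^sup>+\<tau>. (if a * norm x < \<tau> then \<phi> \<tau> else 0) \<partial>lborel) \<partial>\<nu>)"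
  proof (rule nn_integral_cong_AE)
    from AE_nonzero show "AE x in \<nu>. ennreal (if a * norm x < 1 then a ^ ?N * (sqrt (1 - (a * norm x)\<^sup>2) / (a * norm x)) ^ d else 0)
      = ennreal d * (\<integral>\<^sup>+\<tau>. (if a * norm x < \<tau> then \<phi> \<tau> else 0) \<partial>lborel)"
    proof eventually_elim
      case (elim x)
      define T where "T = a * norm x"
      have T: "T > 0" using elim a by (simp add: T_def)
      have "AE \<tau> in lborel. \<tau> \<notin> {T}" by (intro AE_not_in) auto
      then have "(\<integral>\<^sup>+\<tau>. (if T < \<tau> then \<phi> \<tau> else 0) \<partial>lborel)
        = (\<integral>\<^sup>+\<tau>. ennreal (a ^ ?N) * (ennreal (?u \<tau>) * indicator {T..1} \<tau>) \<partial>lborel)"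
        by (intro nn_integral_cong_AE, eventually_elim)
          (use T a in \<open>auto simp: \<phi>_def indicator_def ennreal_mult[symmetric]\<close>)
      also have "\<dots> = ennreal (a ^ ?N) * ennreal (if T < 1 then (sqrt (1 - T\<^sup>2) / T) ^ d / real d else 0)"
        by (subst nn_integral_cmult) (auto simp: nn_integral_profile_density[OF T d(1)] simp del: power_Suc)
      finally have "ennreal d * (\<integral>\<^sup>+\<tau>. (if T < \<tau> then \<phi> \<tau> else 0) \<partial>lborel)
         = ennreal d * (ennreal (a ^ ?N) * ennreal (if T < 1 then (sqrt (1 - T\<^sup>2) / T) ^ d / real d else 0))"
        by simp
      also have "\<dots> = ennreal (if T < 1 then a ^ ?N * (sqrt (1 - T\<^sup>2) / T) ^ d else 0)"
        using a T d(1) by (auto simp: ennreal_mult[symmetric] abs_square_le_1)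
      finally show ?case by (simp add: T_def)
    qed
  qed
  also have "\<dots> = ennreal d * (\<integral>\<^sup>+x. (\<integral>\<^sup>+\<tau>. (if a * norm x < \<tau> then \<phi> \<tau> else 0) \<partial>lborel) \<partial>\<nu>)"
    by (rule nn_integral_cmult) measurable
  also have "\<dots> = ennreal d * (\<integral>\<^sup>+\<tau>. N_mass \<nu> (\<tau> / a) * \<phi> \<tau> \<partial>lborel)"
    using a by (subst layer_cake) auto
  also have "(\<integral>\<^sup>+\<tau>. N_mass \<nu> (\<tau> / a) * \<phi> \<tau> \<partial>lborel) = (\<integral>\<^sup>+\<tau>. ennreal (indicator {0..1} \<tau> * (enn2real (N_mass \<nu> (\<tau> / a)) / (\<tau> / a) ^ ?N
              * (1 - \<tau>\<^sup>2) powr ((real ?N - 3) / 2))) \<partial>lborel)"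
  proof (rule nn_integral_cong)
    fix \<tau> :: real
    have N: "N_mass \<nu> (\<tau> / a) = ennreal (enn2real (N_mass \<nu> (\<tau> / a)))"
      using N_mass_finite[of "\<tau> / a"] by simp
    show "N_mass \<nu> (\<tau> / a) * \<phi> \<tau> = ennreal (indicator {0..1} \<tau> * (enn2real (N_mass \<nu> (\<tau> / a)) / (\<tau> / a) ^ ?N
              * (1 - \<tau>\<^sup>2) powr ((real ?N - 3) / 2)))"
      by (subst N) (use a in \<open>auto simp: \<phi>_def d indicator_def ennreal_mult[symmetric] power_divide field_simps simp del: ennreal_enn2real power_Suc\<close>)
  qed
  finally show ?thesis unfolding d_def .
qed

end

section \<open>The asymptotics of the spherical average\<close>

lemma diagonal_mult_vec:
  fixes a :: "real^'n^'n"
  assumes "\<And>i j. i \<noteq> j \<Longrightarrow> a $ i $ j = 0"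
  shows "a *v y = (\<chi> i. a $ i $ i * y $ i)"
proof -
  have "(\<Sum>j\<in>UNIV. a $ i $ j * y $ j) = (\<Sum>j\<in>UNIV. if j = i then a $ i $ i * y $ i else 0)" for i
    using assms by (intro sum.cong) auto
  then show ?thesis by (simp add: matrix_vector_mult_def)
qed

text \<open>
By homogeneity, the radial projection of \<open>y\<close> to the sphere through \<open>x\<close> lies in the ellipsoid if and only if
\<open>norm x * norm (a *v y) < norm y\<close>.
\<close>

lemma (in Haar_SO) expectation_ball_eq_needle:
  fixes a :: "real^'n^'n"
  assumes "2 \<le> CARD('n)" and diag: "\<And>i j. i \<noteq> j \<Longrightarrow> a $ i $ j = 0" and x: "x \<noteq> 0"
  shows "unit_ball_vol CARD('n) * (LINT k|m. indicator (ball 0 1) ((a ** k) *v x))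
    = measure lborel (needle (\<lambda>i. a $ i $ i) (norm x))"
proof -
  let ?V = "needle (\<lambda>i. a $ i $ i) (norm x)"
  have ball [measurable]: "ball 0 1 \<in> sets (borel :: (real^'n) measure)" by simp
  have V [measurable]: "?V \<in> sets borel" by (rule borel_open[OF open_needle])
  define f where "f z = (indicator (ball 0 1) (a *v z) :: ennreal)" for z
  have f [measurable]: "f \<in> borel_measurable borel"
    unfolding f_def by measurable
  have "(\<integral>\<^sup>+k. f (k *v x) \<partial>m) * emeasure lborel (ball 0 1 :: (real^'n) set)
      = (\<integral>\<^sup>+y. f ((norm x / norm y) *\<^sub>R y) * indicator (ball 0 1) y \<partial>lborel)"
    by (rule nn_integral_orbit) (use assms in auto)
  also have "\<dots> = (\<integral>\<^sup>+y. indicator ?V y \<partial>lborel)"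
  proof (rule nn_integral_cong_AE)
    have "AE y in lborel. y \<notin> {0::real^'n}"
      by (intro AE_not_in) auto
    then show "AE y in lborel. f ((norm x / norm y) *\<^sub>R y) * indicator (ball 0 1) y = indicator ?V y"
    proof eventually_elim
      case (elim y)
      then have "norm (a *v ((norm x / norm y) *\<^sub>R y)) < 1 \<longleftrightarrow> norm x * norm (a *v y) < norm y"
        by (simp add: matrix_vector_mult_scaleR pos_divide_less_eq)
      then show ?case
        by (auto simp: f_def indicator_def mem_needle_iff_norm diagonal_mult_vec[OF diag])
    qed
  qed
  also have "\<dots> = emeasure lborel ?V" by simp
  finally have *: "(\<integral>\<^sup>+k. f (k *v x) \<partial>m) * emeasure lborel (ball 0 1 :: (real^'n) set) = emeasure lborel ?V" .
  have "(LINT k|m. indicator (ball 0 1) ((a ** k) *v x)) = enn2real (\<integral>\<^sup>+k. f (k *v x) \<partial>m)"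
  proof (subst integral_eq_nn_integral)
    show "(\<lambda>k. indicat_real (ball 0 1) ((a ** k) *v x)) \<in> borel_measurable m"
      by measurable
    show "enn2real (\<integral>\<^sup>+k. ennreal (indicator (ball 0 1) ((a ** k) *v x)) \<partial>m) = enn2real (\<integral>\<^sup>+k. f (k *v x) \<partial>m)"
      by (intro arg_cong[where f=enn2real] nn_integral_cong)
        (auto simp: f_def indicator_def matrix_vector_mul_assoc)
  qed auto
  with arg_cong[OF *, of enn2real] show ?thesis
    by (simp add: emeasure_ball enn2real_mult measure_def mult.commute)
qed

context
  fixes a :: "real^'n::{finite,linorder}^'n::{finite,linorder}"
  assumes A: "a \<in> A_plus" and dim: "CARD('n) > 1"
begin

lemma A_plus_diag: "i \<noteq> j \<Longrightarrow> a $ i $ j = 0"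
  and A_plus_pos: "a $ i $ i > 0"
  and A_plus_prod: "(\<Prod>i\<in>UNIV. a $ i $ i) = 1"
proof -
  show d: "i \<noteq> j \<Longrightarrow> a $ i $ j = 0" for i j using A by (simp add: A_plus_def)
  show "a $ i $ i > 0" using A by (simp add: A_plus_def)
  show "(\<Prod>i\<in>UNIV. a $ i $ i) = 1"
    using A det_diagonal[of a] d by (simp add: A_plus_def)
qed

lemma A_plus_penultimate_le:
  assumes "i \<noteq> last_index"
  shows "a $ penultimate_index $ penultimate_index \<le> a $ i $ i"
proof -
  have "i \<le> penultimate_index"
    unfolding penultimate_index_def using assms by (intro Max_ge) auto
  then show ?thesis using A by (cases "i = penultimate_index") (auto simp: A_plus_def less_le)
qed

end

theorem theorem5p12:
  assumes "CARD('n::{finite,linorder}) > 1"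
  shows "\<exists>C::real. \<forall>m_K :: (real^'n::{finite,linorder}^'n::{finite,linorder}) measure. \<forall>\<nu> :: (real^'n::{finite,linorder}) measure. \<forall>a :: real^'n::{finite,linorder}^'n::{finite,linorder}.
    normalized_Haar_SO m_K \<longrightarrow> sets \<nu> = sets borel \<longrightarrow> M_sup \<nu> < \<infinity> \<longrightarrow> a \<in> A_plus \<longrightarrow>
    (let a_N = a $ last_index $ last_index;
         a_N1 = a $ penultimate_index $ penultimate_index
     in a_N / a_N1 < 1/4 \<longrightarrow>
        \<bar>(LINT x|\<nu>. LINT k|m_K. indicator (ball 0 1) ((a ** k) *v x))
         - 2 * sphere_area (CARD('n) - 1) / sphere_area CARD('n) *
           (LBINT \<tau>:{0..1}. enn2real (N_mass \<nu> (\<tau> / a_N)) / (\<tau> / a_N) ^ CARD('n)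
              * (1 - \<tau>\<^sup>2) powr ((real CARD('n) - 3) / 2))\<bar>
        \<le> C * enn2real (M_sup \<nu>) * (a_N / a_N1) powr (2/3))"
proof -
  let ?N = "CARD('n)"
  define K where "K = error_const ?N"
  define R where "R = singular_power_const ?N"
  define \<omega> where "\<omega> = unit_ball_vol ?N"
  define \<kappa> where "\<kappa> = unit_cone_vol ?N"
  have \<omega>: "\<omega> > 0" unfolding \<omega>_def by (rule unit_ball_vol_pos) simp
  have \<kappa>: "\<kappa> \<ge> 0" by (simp add: \<kappa>_def)
  have K: "K \<ge> 0" by (simp add: K_def error_const_def)
  have dim: "2 \<le> ?N" using assms by simp
  show ?thesis
  proof (intro exI[of _ "K * R / \<omega>"] allI impI, unfold Let_def, intro impI)
    fix m_K :: "(real^'n::_^'n::_) measure" and \<nu> :: "(real^'n::_) measure" and a :: "real^'n::_^'n::_"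
    assume Haar: "normalized_Haar_SO m_K" and sets: "sets \<nu> = sets borel"
      and M: "M_sup \<nu> < \<infinity>" and A: "a \<in> A_plus"
    interpret Haar_SO m_K by standard (rule Haar)
    interpret \<nu>: ball_growth \<nu> by standard (fact sets M)+
    let ?l = "last_index :: 'n" and ?p = "penultimate_index :: 'n"
    define \<alpha> where "\<alpha> = a $ ?l $ ?l"
    define \<delta> where "\<delta> = \<alpha> / a $ ?p $ ?p"
    assume "a $ ?l $ ?l / a $ ?p $ ?p < 1/4"
    then have \<delta>: "\<delta> < 1/4" by (simp add: \<delta>_def \<alpha>_def)
    have pos: "a $ i $ i > 0" for i using A_plus_pos[OF A assms] .
    have \<alpha>: "\<alpha> > 0" and \<delta>_pos: "\<delta> > 0" using pos by (simp_all add: \<alpha>_def \<delta>_def)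
    have gap: "a $ ?l $ ?l \<le> \<delta> * a $ i $ i" if "i \<noteq> ?l" for i
    proof -
      have "\<delta> * a $ ?p $ ?p \<le> \<delta> * a $ i $ i"
        using A_plus_penultimate_le[OF A assms that] \<delta>_pos by (intro mult_left_mono) auto
      then show ?thesis using pos[of ?p] by (simp add: \<delta>_def \<alpha>_def)
    qed
    define g where "g x = (LINT k|m_K. indicator (ball 0 1) ((a ** k) *v x) :: real)" for x
    define W where "W x = (if \<alpha> * norm x < 1
        then \<alpha> ^ ?N * (sqrt (1 - (\<alpha> * norm x)\<^sup>2) / (\<alpha> * norm x)) ^ (?N - 1) else 0)" for x :: "real^'n::_"
    define H where "H x = (if \<alpha> * norm x < 1
        then \<alpha> ^ ?N * (\<alpha> * norm x) powr (1/3 - ?N) else 0)" for x :: "real^'n::_"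
    define I where "I = (LBINT \<tau>:{0..1}. enn2real (N_mass \<nu> (\<tau> / \<alpha>)) / (\<tau> / \<alpha>) ^ ?N
              * (1 - \<tau>\<^sup>2) powr ((real ?N - 3) / 2))"
    have [measurable]: "ball 0 1 \<in> sets (borel :: (real^'n::_) measure)" by simp
    have g_meas [measurable]: "g \<in> borel_measurable \<nu>"
      unfolding g_def by (rule borel_measurable_lebesgue_integral) measurable
    have W_meas [measurable]: "W \<in> borel_measurable \<nu>" unfolding W_def by measurable
    have H_meas [measurable]: "H \<in> borel_measurable \<nu>" unfolding H_def by measurable
    have H_nonneg: "H x \<ge> 0" for x using \<alpha> by (simp add: H_def)
    have H_nn: "(\<integral>\<^sup>+x. ennreal (H x) \<partial>\<nu>) \<le> ennreal (R * \<nu>.M)"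
      unfolding H_def R_def by (rule \<nu>.nn_integral_singular_power_le[OF \<alpha>])
    have H_int: "integrable \<nu> H"
      using H_nn H_nonneg by (intro integrableI_nonneg) (auto intro: le_less_trans)
    have RM: "R * \<nu>.M \<ge> 0" using \<nu>.M_nonneg by (simp add: R_def singular_power_const_def)
    have H_le: "(LINT x|\<nu>. H x) \<le> R * \<nu>.M"
      using H_nn H_nonneg RM by (simp add: integral_eq_nn_integral enn2real_leI)
    \<comment> \<open>The second conjunct makes \<open>W\<close> integrable; the first then does the same for \<open>g\<close>.\<close>
    have key: "AE x in \<nu>. \<bar>\<omega> * g x - \<kappa> * W x\<bar> \<le> K * \<delta> powr (2/3) * H x \<and> \<bar>W x\<bar> \<le> H x"
      using \<nu>.AE_nonzero
    proof eventually_elim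
      case (elim x)
      define T where "T = \<alpha> * norm x"
      have T: "T > 0" using elim \<alpha> by (simp add: T_def)
      have "\<omega> * g x = measure lborel (needle (\<lambda>i. a $ i $ i) (norm x))"
        unfolding \<omega>_def g_def using elim A_plus_diag[OF A assms]
        by (intro expectation_ball_eq_needle[OF dim]) auto
      moreover have "\<bar>measure lborel (needle (\<lambda>i. a $ i $ i) (norm x)) - \<kappa> * W x\<bar>
        \<le> (if T < 1 then K * (\<alpha> ^ ?N / T ^ (?N - 1)) * (\<delta> / T) powr (2/3) else 0)"
        using needle_approx[OF dim pos A_plus_prod[OF A assms], of "norm x" T ?l \<delta>] elim \<delta> \<delta>_pos gap
        by (simp add: T_def \<alpha>_def W_def K_def error_const_def \<kappa>_def if_distrib mult_ac cong: if_cong)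
      moreover have pw: "1 / T ^ (?N - 1) * (1 / T powr (2/3)) = T powr (1/3 - ?N)"
      proof -
        have "T powr (1/3 - ?N) = T powr (- real (?N - 1) - 2/3)" using dim by (simp add: of_nat_diff)
        also have "\<dots> = 1 / T powr real (?N - 1) * (1 / T powr (2/3))"
          by (simp only: diff_conv_add_uminus powr_add powr_minus_divide)
        finally show ?thesis unfolding powr_realpow[OF T] by (rule sym)
      qed
      have "(\<delta> / T) powr (2/3) = \<delta> powr (2/3) * (1 / T powr (2/3))"
        using T \<delta>_pos by (simp add: powr_divide)
      then have "(if T < 1 then K * (\<alpha> ^ ?N / T ^ (?N - 1)) * (\<delta> / T) powr (2/3) else 0) = K * \<delta> powr (2/3) * H x"
        by (simp add: H_def T_def[symmetric] pw[symmetric])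
      ultimately have 1: "\<bar>\<omega> * g x - \<kappa> * W x\<bar> \<le> K * \<delta> powr (2/3) * H x" by simp
      have "\<bar>W x\<bar> \<le> H x"
      proof (cases "T < 1")
        case True
        have T2: "T\<^sup>2 < 1" using T True by (simp add: abs_square_less_1)
        have "sqrt (1 - T\<^sup>2) ^ (?N - 1) \<le> 1" using T2 by (intro power_le_one) auto
        moreover have "1 \<le> 1 / T powr (2/3)"
          using T True by (simp add: powr_le1)
        ultimately have "1 / T ^ (?N - 1) * sqrt (1 - T\<^sup>2) ^ (?N - 1) \<le> 1 / T ^ (?N - 1) * (1 / T powr (2/3))"
          using T by (intro mult_left_mono[OF order_trans]) (assumption, assumption, simp)
        then have "\<alpha> ^ ?N * (sqrt (1 - T\<^sup>2) / T) ^ (?N - 1) \<le> \<alpha> ^ ?N * T powr (1/3 - ?N)"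
          unfolding pw using \<alpha> by (intro mult_left_mono) (auto simp: power_divide)
        moreover have "\<alpha> ^ ?N * (sqrt (1 - T\<^sup>2) / T) ^ (?N - 1) \<ge> 0"
          using \<alpha> T T2 by simp
        ultimately show ?thesis using True by (simp add: W_def H_def T_def)
      qed (simp add: W_def H_def T_def)
      with 1 show ?case ..
    qed
    have W_int: "integrable \<nu> W"
      by (rule Bochner_Integration.integrable_bound[OF H_int]) (use key H_nonneg in auto)
    define D where "D x = \<omega> * g x - \<kappa> * W x" for x
    have D_meas [measurable]: "D \<in> borel_measurable \<nu>" unfolding D_def by measurable
    have KH_int: "integrable \<nu> (\<lambda>x. K * \<delta> powr (2/3) * H x)" using H_int by simp
    have D_bound: "AE x in \<nu>. \<bar>D x\<bar> \<le> K * \<delta> powr (2/3) * H x"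
      using key by (auto simp: D_def)
    have D_int: "integrable \<nu> D"
      by (rule Bochner_Integration.integrable_bound[OF KH_int]) (use key H_nonneg K in \<open>auto simp: D_def\<close>)
    have g_eq: "g x = (D x + \<kappa> * W x) / \<omega>" for x using \<omega> by (simp add: D_def)
    have int_g: "(LINT x|\<nu>. g x) = ((LINT x|\<nu>. D x) + \<kappa> * (LINT x|\<nu>. W x)) / \<omega>"
      unfolding g_eq using D_int W_int by simp
    have "\<bar>LINT x|\<nu>. D x\<bar> \<le> (LINT x|\<nu>. \<bar>D x\<bar>)" by (rule integral_abs_bound)
    also have "\<dots> \<le> (LINT x|\<nu>. K * \<delta> powr (2/3) * H x)"
      by (rule integral_mono_AE[OF integrable_abs[OF D_int] KH_int D_bound])
    also have "\<dots> = K * \<delta> powr (2/3) * (LINT x|\<nu>. H x)" by simp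
    also have "\<dots> \<le> K * \<delta> powr (2/3) * (R * \<nu>.M)" using H_le K by (intro mult_left_mono) auto
    finally have D_le: "\<bar>LINT x|\<nu>. D x\<bar> \<le> K * \<delta> powr (2/3) * (R * \<nu>.M)" .
    have W_nonneg: "W x \<ge> 0" for x
      using \<alpha> by (auto simp: W_def abs_square_le_1)
    have "(LINT x|\<nu>. W x) = enn2real (\<integral>\<^sup>+x. ennreal (W x) \<partial>\<nu>)"
      using W_nonneg by (intro integral_eq_nn_integral) auto
    also have "\<dots> = enn2real (ennreal (real (?N - 1)) * (\<integral>\<^sup>+\<tau>. ennreal (indicator {0..1} \<tau> * (enn2real (N_mass \<nu> (\<tau> / \<alpha>)) / (\<tau> / \<alpha>) ^ ?N
              * (1 - \<tau>\<^sup>2) powr ((real ?N - 3) / 2))) \<partial>lborel))"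
      unfolding W_def \<nu>.nn_integral_profile[OF \<alpha> dim] ..
    also have "\<dots> = real (?N - 1) * I"
    proof -
      have [measurable]: "(\<lambda>\<tau>. N_mass \<nu> (\<tau> / \<alpha>)) \<in> borel_measurable borel" by (rule \<nu>.N_mass_measurable[OF \<alpha>])
      have "I = enn2real (\<integral>\<^sup>+\<tau>. ennreal (indicator {0..1} \<tau> * (enn2real (N_mass \<nu> (\<tau> / \<alpha>)) / (\<tau> / \<alpha>) ^ ?N
              * (1 - \<tau>\<^sup>2) powr ((real ?N - 3) / 2))) \<partial>lborel)"
        unfolding I_def set_lebesgue_integral_def real_scaleR_def
        using \<alpha> by (intro integral_eq_nn_integral) (auto simp: indicator_def)
      then show ?thesis by (simp add: enn2real_mult)
    qed
    finally have W_eq: "(LINT x|\<nu>. W x) = real (?N - 1) * I" .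
    have "2 * sphere_area (?N - 1) / sphere_area ?N = \<kappa> * real (?N - 1) / \<omega>"
      using dim \<omega> by (simp add: sphere_area_def \<kappa>_def unit_cone_vol_def \<omega>_def)
    then have "(LINT x|\<nu>. g x) - 2 * sphere_area (?N - 1) / sphere_area ?N * I = (LINT x|\<nu>. D x) / \<omega>"
      by (simp add: int_g W_eq add_divide_distrib)
    then have "\<bar>(LINT x|\<nu>. g x) - 2 * sphere_area (?N - 1) / sphere_area ?N * I\<bar> = \<bar>LINT x|\<nu>. D x\<bar> / \<omega>"
      using \<omega> by simp
    also have "\<dots> \<le> (K * \<delta> powr (2/3) * (R * \<nu>.M)) / \<omega>"
      using D_le \<omega> by (intro divide_right_mono) auto
    also have "\<dots> = K * R / \<omega> * enn2real (M_sup \<nu>) * \<delta> powr (2/3)"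
      by (simp add: \<nu>.M_def)
    finally show "\<bar>(LINT x|\<nu>. LINT k|m_K. indicator (ball 0 1) ((a ** k) *v x))
         - 2 * sphere_area (CARD('n) - 1) / sphere_area CARD('n) *
           (LBINT \<tau>:{0..1}. enn2real (N_mass \<nu> (\<tau> / a $ ?l $ ?l)) / (\<tau> / a $ ?l $ ?l) ^ CARD('n)
              * (1 - \<tau>\<^sup>2) powr ((real CARD('n) - 3) / 2))\<bar>
        \<le> K * R / \<omega> * enn2real (M_sup \<nu>) * (a $ ?l $ ?l / a $ ?p $ ?p) powr (2/3)"
      unfolding g_def I_def \<delta>_def \<alpha>_def .
  qed
qed

end
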